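(* There is a deterministic distributed algorithm in the CONGEST model that, for weighted TAP, computes a $2$-approximation (i.e., an augmentation $Aug$ with $T\cup Aug$ $2$-edge-connected and $w(Aug)\le 2\,w(OPT)$, where $OPT$ is a minimum-weight augmentation) and runs in $O(h)$ rounds, where $h$ is the height of the input tree $T$.
   Context: CONGEST model: the network is an undirected connected $n$-vertex graph $G=(V,E)$; computation proceeds in synchronous rounds, and in each round every vertex may send a message of $O(\log n)$ bits to each of its neighbours; complexity is the number of rounds. Weighted Tree Augmentation Problem (TAP): the input is a $2$-edge-connected graph $G$ (the network) with non-negative edge weights representable in $O(\log n)$ bits, and a spanning tree $T$ of $G$ rooted at a vertex $r$; each vertex knows which of its incident edges belong to $T$ and which one leads to its parent in $T$. The goal is to find a set $Aug$ of edges of $G$ of minimum total weight such that $T\cup Aug$ is $2$-edge-connected (remains connected after deleting any single edge). At the end each vertex must know which of its incident edges are in $Aug$. The height $h$ of $T$ is the maximum distance in $T$ from $r$ to a vertex. *)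

theory Defs
  imports Complex_Main
begin

section \<open>Undirected simple graphs\<close>

text \<open>A graph is given by a vertex set and a set of two-element sets of vertices. Vertices are
  natural numbers, because in a network a vertex is the same thing as its unique identifier.\<close>

definition simple_graph :: "nat set \<Rightarrow> nat set set \<Rightarrow> bool" where
  "simple_graph V E \<longleftrightarrow> finite V \<and> (\<forall>e\<in>E. e \<subseteq> V \<and> card e = 2)"

definition adj :: "nat set set \<Rightarrow> (nat \<times> nat) set" where
  "adj E = {(u, v). {u, v} \<in> E}"

definition graph_connected :: "nat set \<Rightarrow> nat set set \<Rightarrow> bool" where
  "graph_connected V E \<longleftrightarrow> (\<forall>u\<in>V. \<forall>v\<in>V. (u, v) \<in> (adj E)\<^sup>*)"

definition two_edge_connected :: "nat set \<Rightarrow> nat set set \<Rightarrow> bool" where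
  "two_edge_connected V E \<longleftrightarrow>
     graph_connected V E \<and> (\<forall>e\<in>E. graph_connected V (E - {e}))"

definition graph_cycle :: "nat set set \<Rightarrow> nat list \<Rightarrow> bool" where
  "graph_cycle E xs \<longleftrightarrow>
     length xs \<ge> 3 \<and> distinct xs \<and> successively (\<lambda>u v. {u, v} \<in> E) xs \<and> {last xs, hd xs} \<in> E"

definition spanning_tree :: "nat set \<Rightarrow> nat set set \<Rightarrow> nat set set \<Rightarrow> bool" where
  "spanning_tree V E T \<longleftrightarrow> T \<subseteq> E \<and> graph_connected V T \<and> (\<nexists>xs. graph_cycle T xs)"

definition graph_dist :: "nat set set \<Rightarrow> nat \<Rightarrow> nat \<Rightarrow> nat" where
  "graph_dist E u v = (LEAST k. (u, v) \<in> adj E ^^ k)"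

definition height :: "nat set \<Rightarrow> nat set set \<Rightarrow> nat \<Rightarrow> nat" where
  "height V T r = Max (graph_dist T r ` V)"

definition parent :: "nat set set \<Rightarrow> nat \<Rightarrow> nat \<Rightarrow> nat option" where
  "parent T r v =
     (if v = r then None
      else Some (THE u. {u, v} \<in> T \<and> graph_dist T r v = Suc (graph_dist T r u)))"


section \<open>The deterministic CONGEST model\<close>

text \<open>A history lists, round by round, the message received from each vertex. The empty bit
  string stands for no message. As local computation is free, the state of a vertex can be taken
  to be its local input together with its history. An algorithm determines from these the message
  for each neighbour, and whether to halt and with which output. It is independent of the network
  it is run on; in particular, a vertex knows the number of vertices only if its local input or
  the messages it receives reveal it.\<close>

type_synonym history = "(nat \<Rightarrow> bool list) list"

record ('i, 'o) congest_algorithm =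
  message :: "'i \<Rightarrow> history \<Rightarrow> nat \<Rightarrow> bool list"
  result :: "'i \<Rightarrow> history \<Rightarrow> 'o option"

text \<open>The message sent by \<open>u\<close> to \<open>v\<close>, where \<open>I\<close> assigns the local inputs and \<open>H\<close> the current
  histories. A vertex which has halted is silent, and its history is frozen in \<open>run\<close>, so that its
  output is irrevocable.\<close>

definition sent ::
  "('i, 'o) congest_algorithm \<Rightarrow> nat set set \<Rightarrow> (nat \<Rightarrow> 'i) \<Rightarrow> (nat \<Rightarrow> history) \<Rightarrow>
     nat \<Rightarrow> nat \<Rightarrow> bool list" where
  "sent A E I H u v =
     (if {u, v} \<in> E \<and> result A (I u) (H u) = None then message A (I u) (H u) v else [])"

text \<open>The histories of all vertices after \<open>t\<close> rounds:\<close>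

primrec run ::
  "('i, 'o) congest_algorithm \<Rightarrow> nat set set \<Rightarrow> (nat \<Rightarrow> 'i) \<Rightarrow> nat \<Rightarrow> nat \<Rightarrow> history" where
  "run A E I 0 = (\<lambda>v. [])"
| "run A E I (Suc t) =
     (\<lambda>v. if result A (I v) (run A E I t v) = None
          then run A E I t v @ [\<lambda>u. sent A E I (run A E I t) u v]
          else run A E I t v)"

definition bandwidth_at_most ::
  "real \<Rightarrow> ('i, 'o) congest_algorithm \<Rightarrow> nat set set \<Rightarrow> (nat \<Rightarrow> 'i) \<Rightarrow> bool" where
  "bandwidth_at_most b A E I \<longleftrightarrow> (\<forall>t u v. real (length (sent A E I (run A E I t) u v)) \<le> b)"

definition computes_within ::
  "nat \<Rightarrow> ('i, 'o) congest_algorithm \<Rightarrow> nat set \<Rightarrow> nat set set \<Rightarrow> (nat \<Rightarrow> 'i) \<Rightarrow>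
     (nat \<Rightarrow> 'o) \<Rightarrow> bool" where
  "computes_within R A V E I out \<longleftrightarrow> (\<forall>v\<in>V. result A (I v) (run A E I R v) = Some (out v))"


section \<open>Weighted tree augmentation\<close>

definition tap_instance :: "nat set \<Rightarrow> nat set set \<Rightarrow> nat set set \<Rightarrow> nat \<Rightarrow> bool" where
  "tap_instance V E T r \<longleftrightarrow>
     simple_graph V E \<and> two_edge_connected V E \<and> spanning_tree V E T \<and> r \<in> V"

definition augmentation :: "nat set \<Rightarrow> nat set set \<Rightarrow> nat set set \<Rightarrow> nat set set \<Rightarrow> bool" where
  "augmentation V E T Aug \<longleftrightarrow> Aug \<subseteq> E \<and> two_edge_connected V (T \<union> Aug)"

definition optimal_augmentation ::
  "nat set \<Rightarrow> nat set set \<Rightarrow> nat set set \<Rightarrow> (nat set \<Rightarrow> nat) \<Rightarrow> nat set set \<Rightarrow> bool" where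
  "optimal_augmentation V E T w OPT \<longleftrightarrow>
     augmentation V E T OPT \<and> (\<forall>Aug. augmentation V E T Aug \<longrightarrow> sum w OPT \<le> sum w Aug)"

text \<open>What a vertex knows initially. The domain of \<open>edge_weights\<close> is the set of its neighbours;
  the root is the vertex without parent.\<close>

record tap_input =
  own_id :: nat
  edge_weights :: "nat \<Rightarrow> nat option"
  tree_neighbours :: "nat set"
  parent_id :: "nat option"

definition local_input ::
  "nat set set \<Rightarrow> nat set set \<Rightarrow> nat \<Rightarrow> (nat set \<Rightarrow> nat) \<Rightarrow> nat \<Rightarrow> tap_input" where
  "local_input E T r w v =
     \<lparr> own_id = v,
       edge_weights = (\<lambda>u. if {v, u} \<in> E then Some (w {v, u}) else None),
       tree_neighbours = {u. {v, u} \<in> T},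
       parent_id = parent T r v \<rparr>"

text \<open>Identifiers and weights are representable in \<open>O(log n)\<close> bits: \<open>n ^ k\<close> is the number of
  values of \<open>k \<cdot> log 2 n\<close> bits.\<close>

definition log_bit_data :: "nat \<Rightarrow> nat set \<Rightarrow> nat set set \<Rightarrow> (nat set \<Rightarrow> nat) \<Rightarrow> bool" where
  "log_bit_data k V E w \<longleftrightarrow> (\<forall>v\<in>V. v < card V ^ k) \<and> (\<forall>e\<in>E. w e < card V ^ k)"

end

theory Submission
  imports Defs "HOL-Library.Extended_Nat"
begin

text \<open>Every non-tree edge \<open>{a, b}\<close> covers the two upward paths from \<open>a\<close> and from \<open>b\<close> to their
  lowest common ancestor. Treating these paths as separate items of weight \<open>w {a, b}\<close> loses a factor
  of 2, and covering a rooted tree by upward paths is solved exactly by a primal-dual recursion. From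
  the leaves to the root, every vertex \<open>v\<close> computes for every depth \<open>j\<close> above it the least price
  \<open>g v j\<close> of covering the path from \<open>v\<close> up to depth \<open>j\<close> from the subtree of \<open>v\<close>, where a child \<open>c\<close>
  offers its own price minus \<open>y c = g c (depth c - 1)\<close>, the price of its parent edge. The numbers
  \<open>y\<close> form a feasible dual solution, and tracing the minimisers back from the root yields a cover of
  weight \<open>\<Sum> y\<close>. Prices never exceed the largest weight, so each fits into a message, and
  sending them in order of decreasing \<open>j\<close> pipelines the recursion into \<open>O(h)\<close> rounds.

  The messages are the same for all neighbours, and the schedule is driven by the clock: each vertex
  streams the identifiers of its ancestors, the root detects the height \<open>h\<close> and broadcasts it, and
  then \<open>v\<close> sends \<open>g v j\<close> in round \<open>4 h + 1 - depth v - j\<close>, its choice in round \<open>4 h + 2 + depth v\<close>, and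
  halts after \<open>5 h + 3\<close> rounds.\<close>

section \<open>Rooted spanning trees\<close>

locale rooted_tree =
  fixes V :: "nat set" and E T :: "nat set set" and r :: nat
  assumes inst: "tap_instance V E T r"
begin

abbreviation depth :: "nat \<Rightarrow> nat" where
  "depth \<equiv> graph_dist T r"

definition pr :: "nat \<Rightarrow> nat" where
  "pr v = (THE u. {u, v} \<in> T \<and> depth v = Suc (depth u))"

definition children :: "nat \<Rightarrow> nat set" where
  "children v = {c \<in> V - {r}. pr c = v}"

definition ancestors :: "nat \<Rightarrow> nat set" where
  "ancestors v = {(pr ^^ k) v | k. k \<le> depth v}"

lemma finite_V: "finite V"
  and T_sub_E: "T \<subseteq> E"
  and root_in_V: "r \<in> V"
  and T_connected: "graph_connected V T"
  and E_2ec: "two_edge_connected V E"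
  using inst by (auto simp: tap_instance_def simple_graph_def spanning_tree_def)

lemma edge_V: "{u, v} \<in> E \<Longrightarrow> u \<in> V \<and> v \<in> V"
  and edge_neq: "{u, v} \<in> E \<Longrightarrow> u \<noteq> v"
  using inst unfolding tap_instance_def simple_graph_def by fastforce+

lemma edge_E_cases:
  assumes "e \<in> E"
  obtains a b where "e = {a, b}" "a \<noteq> b"
proof -
  have "card e = 2"
    using inst assms by (simp add: tap_instance_def simple_graph_def)
  then show thesis
    using that by (auto simp: card_2_iff)
qed

lemma finite_E: "finite E"
proof (rule finite_subset)
  show "E \<subseteq> Pow V"
    using inst by (auto simp: tap_instance_def simple_graph_def)
qed (simp add: finite_V)

lemma depth_root: "depth r = 0"
  unfolding graph_dist_def by (rule Least_eq_0) simp

lemma depth_reach: "v \<in> V \<Longrightarrow> (r, v) \<in> adj T ^^ depth v"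
proof -
  assume "v \<in> V"
  then have "(r, v) \<in> (adj T)\<^sup>*"
    using T_connected root_in_V by (simp add: graph_connected_def)
  then obtain k where "(r, v) \<in> adj T ^^ k"
    using rtrancl_imp_relpow by blast
  then show ?thesis
    unfolding graph_dist_def by (rule LeastI)
qed

lemma depth_le: "(r, v) \<in> adj T ^^ k \<Longrightarrow> depth v \<le> k"
  unfolding graph_dist_def by (rule Least_le)

lemma depth_eq_0: "v \<in> V \<Longrightarrow> depth v = 0 \<longleftrightarrow> v = r"
  using depth_reach[of v] depth_root by auto

lemma ex_parent:
  assumes "v \<in> V" "v \<noteq> r"
  shows "\<exists>u. {u, v} \<in> T \<and> depth v = Suc (depth u)"
proof -
  obtain m where m: "depth v = Suc m"
    using assms depth_eq_0 not0_implies_Suc by blast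
  then obtain u where u: "(r, u) \<in> adj T ^^ m" "(u, v) \<in> adj T"
    using depth_reach[OF assms(1)] by auto
  then have "{u, v} \<in> T"
    by (simp add: adj_def)
  then have "u \<in> V"
    using T_sub_E edge_V by blast
  have "(r, v) \<in> adj T ^^ Suc (depth u)"
    using depth_reach[OF \<open>u \<in> V\<close>] u(2) by auto
  from depth_le[OF this] depth_le[OF u(1)] m have "depth u = m"
    by simp
  then show ?thesis
    using \<open>{u, v} \<in> T\<close> m by auto
qed

text \<open>An edge outside the parent relation closes a cycle with the two upward chains of its
  endpoints, cut at the point where they first meet.\<close>

lemma T_edge_parent:
  assumes \<pi>: "\<And>v. v \<in> V \<Longrightarrow> v \<noteq> r \<Longrightarrow> {\<pi> v, v} \<in> T \<and> depth v = Suc (depth (\<pi> v))"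
    and uv: "{u, v} \<in> T"
  shows "u \<noteq> r \<and> \<pi> u = v \<or> v \<noteq> r \<and> \<pi> v = u"
proof (rule ccontr)
  assume contra: "\<not> ?thesis"
  have uV: "u \<in> V" and vV: "v \<in> V" and "u \<noteq> v"
    using uv T_sub_E edge_V edge_neq by blast+
  have chain: "(\<pi> ^^ i) x \<in> V \<and> depth ((\<pi> ^^ i) x) = depth x - i"
    if "x \<in> V" "i \<le> depth x" for x i
    using that(2)
  proof (induction i)
    case (Suc i)
    let ?y = "(\<pi> ^^ i) x"
    from Suc have y: "?y \<in> V" "depth ?y = depth x - i"
      by auto
    with Suc.prems have "?y \<noteq> r"
      using depth_root by auto
    then have "{\<pi> ?y, ?y} \<in> T \<and> depth ?y = Suc (depth (\<pi> ?y))"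
      using \<pi> y by blast
    then show ?case
      using T_sub_E edge_V y by auto
  qed (simp add: that)
  have chain_edge: "{(\<pi> ^^ i) x, (\<pi> ^^ Suc i) x} \<in> T" if "x \<in> V" "i < depth x" for x i
  proof -
    have "(\<pi> ^^ i) x \<noteq> r"
      using chain[of x i] that depth_root by auto
    then show ?thesis
      using \<pi>[of "(\<pi> ^^ i) x"] chain[of x i] that by (simp add: insert_commute)
  qed
  have top: "(\<pi> ^^ depth x) x = r" if "x \<in> V" for x
    using chain[of x "depth x"] that depth_eq_0 by auto
  \<comment> \<open>\<open>k\<close> is the first index at which the chain of \<open>u\<close> hits
    that of \<open>v\<close>; its minimality keeps the two arms of the cycle disjoint.\<close>
  define P where "P k \<longleftrightarrow> k \<le> depth u \<and> (\<exists>m\<le>depth v. (\<pi> ^^ k) u = (\<pi> ^^ m) v)" for k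
  define k where "k = (LEAST k. P k)"
  have "P (depth u)"
    unfolding P_def using top uV vV by (metis order_refl)
  then have "P k"
    unfolding k_def by (rule LeastI)
  then obtain m where k: "k \<le> depth u" and m: "m \<le> depth v" and meet: "(\<pi> ^^ k) u = (\<pi> ^^ m) v"
    by (auto simp: P_def)
  have least: "\<not> P i" if "i < k" for i
    using that not_less_Least unfolding k_def by blast
  define xs where "xs = map (\<lambda>i. (\<pi> ^^ i) u) [0..<Suc k]"
  define ys where "ys = map (\<lambda>i. (\<pi> ^^ i) v) [0..<m]"
  have inj: "inj_on (\<lambda>i. (\<pi> ^^ i) x) {..depth x}" if "x \<in> V" for x
  proof (rule inj_onI)
    fix i j assume "i \<in> {..depth x}" "j \<in> {..depth x}" "(\<pi> ^^ i) x = (\<pi> ^^ j) x"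
    then show "i = j"
      using chain[of x i] chain[of x j] that by auto
  qed
  have "distinct xs" "distinct ys"
    unfolding xs_def ys_def distinct_map
    using k m by (auto simp del: upt_Suc intro: inj_on_subset[OF inj[OF uV]] inj_on_subset[OF inj[OF vV]])
  moreover have "set xs \<inter> set ys = {}"
  proof (rule ccontr)
    assume "set xs \<inter> set ys \<noteq> {}"
    then obtain i j where ij: "i < Suc k" "j < m" "(\<pi> ^^ i) u = (\<pi> ^^ j) v"
      unfolding xs_def ys_def by (auto simp del: upt_Suc)
    show False
    proof (cases "i = k")
      case True
      then have "(\<pi> ^^ m) v = (\<pi> ^^ j) v"
        using ij meet by simp
      then show False
        using chain[of v m] chain[of v j] vV m ij by auto
    next
      case False
      then have "P i"
        using ij k m unfolding P_def by (intro conjI exI[of _ j]) auto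
      then show False
        using least False ij by auto
    qed
  qed
  ultimately have dist: "distinct (xs @ rev ys)"
    by auto
  have succ_xs: "successively (\<lambda>a b. {a, b} \<in> T) xs"
    unfolding xs_def successively_conv_nth
    using chain_edge[OF uV] k by (simp del: upt_Suc funpow.simps)
  have succ_ys: "successively (\<lambda>a b. {a, b} \<in> T) (rev ys)"
  proof -
    have "{(\<pi> ^^ Suc i) v, (\<pi> ^^ i) v} \<in> T" if "i < m" for i
      using chain_edge[OF vV, of i] that m by (simp add: insert_commute del: funpow.simps)
    then show ?thesis
      unfolding ys_def successively_rev by (simp add: successively_conv_nth del: funpow.simps)
  qed
  have last_xs: "last xs = (\<pi> ^^ m) v"
    unfolding xs_def using meet by simp
  have junction: "{last xs, hd (rev ys)} \<in> T" if "ys \<noteq> []"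
  proof -
    from that obtain m' where m': "m = Suc m'"
      unfolding ys_def by (cases m) auto
    have "hd (rev ys) = (\<pi> ^^ m') v"
      using m' unfolding ys_def by (simp add: hd_rev)
    then show ?thesis
      using chain_edge[OF vV, of m'] m m' last_xs by (simp add: insert_commute)
  qed
  have hd: "hd (xs @ rev ys) = u"
    unfolding xs_def by (simp add: upt_rec del: upt_Suc)
  have last: "last (xs @ rev ys) = v"
  proof (cases m)
    case 0
    then show ?thesis
      using last_xs unfolding ys_def by simp
  next
    case (Suc m')
    then have "hd ys = v" "ys \<noteq> []"
      unfolding ys_def by (auto simp: upt_rec simp del: upt_Suc)
    then show ?thesis
      by (simp add: last_rev)
  qed
  \<comment> \<open>With fewer than three vertices, either \<open>u = v\<close> or one endpoint is
    the parent of the other.\<close>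
  have "length (xs @ rev ys) \<ge> 3"
  proof (rule ccontr)
    assume "\<not> ?thesis"
    then consider "k = 0" "m = 0" | "k = 1" "m = 0" | "k = 0" "m = 1"
      unfolding xs_def ys_def by fastforce
    then show False
    proof cases
      case 1
      then show False using meet \<open>u \<noteq> v\<close> by simp
    next
      case 2
      then have "u \<noteq> r" using k depth_root by auto
      then show False using 2 meet contra by simp
    next
      case 3
      then have "v \<noteq> r" using m depth_root by auto
      then show False using 3 meet contra by simp
    qed
  qed
  moreover have "successively (\<lambda>a b. {a, b} \<in> T) (xs @ rev ys)"
    using succ_xs succ_ys junction by (auto simp: successively_append_iff)
  ultimately have "graph_cycle T (xs @ rev ys)"
    unfolding graph_cycle_def using dist hd last uv by (simp add: insert_commute)
  then show False
    using inst by (auto simp: tap_instance_def spanning_tree_def)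
qed

text \<open>\<open>pr\<close> is a \<open>THE\<close>, so uniqueness comes first. It follows from
  \<open>T_edge_parent\<close> for parents picked by \<open>SOME\<close>: a second candidate
  \<open>u\<close> would have \<open>v\<close> as its parent and hence be deeper than
  \<open>v\<close>.\<close>

lemma parent_pr: assumes "v \<in> V" "v \<noteq> r"
  shows pr_edge: "{pr v, v} \<in> T" and depth_pr: "depth v = Suc (depth (pr v))"
proof -
  define \<pi> where "\<pi> v = (SOME u. {u, v} \<in> T \<and> depth v = Suc (depth u))" for v
  have \<pi>: "{\<pi> v, v} \<in> T \<and> depth v = Suc (depth (\<pi> v))" if "v \<in> V" "v \<noteq> r" for v
    unfolding \<pi>_def using ex_parent[OF that] by (rule someI_ex)
  have "u = \<pi> v" if "{u, v} \<in> T" "depth v = Suc (depth u)" for u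
  proof -
    have "u \<in> V"
      using that(1) T_sub_E edge_V by blast
    then show ?thesis
      using T_edge_parent[of \<pi>, OF \<pi> that(1)] that(2) \<pi>[of u] by auto
  qed
  then have "pr v = \<pi> v"
    unfolding pr_def using \<pi>[OF assms] by (intro the_equality) blast+
  then show "{pr v, v} \<in> T" "depth v = Suc (depth (pr v))"
    using \<pi>[OF assms] by auto
qed

lemma pr_V: "v \<in> V \<Longrightarrow> v \<noteq> r \<Longrightarrow> pr v \<in> V"
  using pr_edge T_sub_E edge_V by blast

lemma tree_edge_cases: "{u, v} \<in> T \<Longrightarrow> u \<noteq> r \<and> pr u = v \<or> v \<noteq> r \<and> pr v = u"
  using T_edge_parent[of pr] parent_pr by blast

lemma parent_eq: "v \<noteq> r \<Longrightarrow> parent T r v = Some (pr v)"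
  by (simp add: parent_def pr_def)

lemma children_V: "c \<in> children v \<Longrightarrow> c \<in> V \<and> c \<noteq> r \<and> pr c = v"
  by (simp add: children_def)

lemma depth_child: "c \<in> children v \<Longrightarrow> depth c = Suc (depth v)"
  using children_V[of c v] depth_pr[of c] by simp

lemma child_edge: "c \<in> children v \<Longrightarrow> {v, c} \<in> T"
  using children_V[of c v] pr_edge[of c] by auto

lemma pr_not_child: "v \<in> V \<Longrightarrow> v \<noteq> r \<Longrightarrow> pr v \<notin> children v"
  using depth_child[of "pr v" v] depth_pr[of v] by auto

lemma tree_nbrs:
  assumes "v \<in> V"
  shows "{u. {v, u} \<in> T} = children v \<union> (if v = r then {} else {pr v})"
proof -
  have "u \<in> V" if "{v, u} \<in> T" for u
    using that T_sub_E edge_V by blast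
  then have "{v, u} \<in> T \<longleftrightarrow> u \<in> children v \<or> v \<noteq> r \<and> u = pr v" for u
    using tree_edge_cases[of v u] child_edge[of u v] pr_edge[OF assms]
    by (auto simp: children_def insert_commute)
  then show ?thesis
    by auto
qed

lemma iter_pr: "v \<in> V \<Longrightarrow> k \<le> depth v \<Longrightarrow> (pr ^^ k) v \<in> V \<and> depth ((pr ^^ k) v) = depth v - k"
proof (induction k)
  case (Suc k)
  then have y: "(pr ^^ k) v \<in> V" "depth ((pr ^^ k) v) = depth v - k"
    by auto
  with Suc.prems have "(pr ^^ k) v \<noteq> r"
    using depth_root by auto
  then show ?case
    using pr_V[OF y(1)] depth_pr[OF y(1)] y by simp
qed simp

lemma ancestors_root: "ancestors r = {r}"
  by (simp add: ancestors_def depth_root)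

lemma ancestors_eq:
  assumes "v \<in> V" "v \<noteq> r"
  shows "ancestors v = insert v (ancestors (pr v))"
proof -
  have "ancestors v = (\<lambda>k. (pr ^^ k) v) ` {..Suc (depth (pr v))}"
    using depth_pr[OF assms] by (auto simp: ancestors_def)
  also have "\<dots> = insert v ((\<lambda>k. (pr ^^ Suc k) v) ` {..depth (pr v)})"
    by (simp add: atMost_Suc_eq_insert_0 image_image)
  also have "(\<lambda>k. (pr ^^ Suc k) v) ` {..depth (pr v)} = ancestors (pr v)"
    by (auto simp: ancestors_def funpow_swap1)
  finally show ?thesis .
qed

lemma self_ancestor: "v \<in> ancestors v"
  unfolding ancestors_def by (intro CollectI exI[of _ 0]) simp

lemma ancestors_V: "v \<in> V \<Longrightarrow> x \<in> ancestors v \<Longrightarrow> x \<in> V"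
  and ancestor_depth_le: "v \<in> V \<Longrightarrow> x \<in> ancestors v \<Longrightarrow> depth x \<le> depth v"
  and ancestor_iter: "v \<in> V \<Longrightarrow> x \<in> ancestors v \<Longrightarrow> x = (pr ^^ (depth v - depth x)) v"
  using iter_pr by (fastforce simp: ancestors_def)+

lemma iter_ancestor: "k \<le> depth v \<Longrightarrow> (pr ^^ k) v \<in> ancestors v"
  by (auto simp: ancestors_def)

lemma root_ancestor: "v \<in> V \<Longrightarrow> r \<in> ancestors v"
  using iter_pr[of v "depth v"] iter_ancestor[of "depth v" v] depth_eq_0 by auto

lemma finite_ancestors: "finite (ancestors v)"
  by (simp add: ancestors_def)

lemma ancestor_of_iter:
  assumes "v \<in> V" "i \<le> k" "k \<le> depth v"
  shows "(pr ^^ k) v \<in> ancestors ((pr ^^ i) v)"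
proof -
  have "(pr ^^ k) v = (pr ^^ (k - i)) ((pr ^^ i) v)"
    using assms(2) by (metis comp_apply funpow_add le_add_diff_inverse2)
  then show ?thesis
    using iter_ancestor[of "k - i" "(pr ^^ i) v"] iter_pr[of v i] assms by simp
qed

lemma ancestor_linear:
  assumes "v \<in> V" "x \<in> ancestors v" "y \<in> ancestors v" "depth x \<le> depth y"
  shows "x \<in> ancestors y"
  using ancestor_of_iter[of v "depth v - depth y" "depth v - depth x"]
    ancestor_iter[of v x] ancestor_iter[of v y] assms by simp

lemma ancestors_trans:
  assumes "v \<in> V" "x \<in> ancestors y" "y \<in> ancestors v"
  shows "x \<in> ancestors v"
proof -
  obtain k where k: "k \<le> depth v" "y = (pr ^^ k) v"
    using assms(3) by (auto simp: ancestors_def)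
  obtain i where i: "i \<le> depth y" "x = (pr ^^ i) y"
    using assms(2) by (auto simp: ancestors_def)
  have "x = (pr ^^ (i + k)) v" "i + k \<le> depth v"
    using i k iter_pr[OF assms(1) k(1)] by (auto simp: funpow_add)
  then show ?thesis
    using iter_ancestor by blast
qed

lemma child_ancestors: "c \<in> children v \<Longrightarrow> v \<in> ancestors c"
  using children_V[of c v] ancestors_eq[of c] self_ancestor by auto

abbreviation ht :: nat where
  "ht \<equiv> height V T r"

lemma depth_le_ht: "v \<in> V \<Longrightarrow> depth v \<le> ht"
  unfolding height_def using finite_V by simp

lemma ht_attained: obtains v where "v \<in> V" "depth v = ht"
  using Max_in[of "depth ` V"] finite_V root_in_V unfolding height_def by fastforce

lemma depth_less_card:
  assumes "v \<in> V"
  shows "depth v < card V"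
proof -
  have "inj_on (\<lambda>k. (pr ^^ k) v) {..depth v}"
  proof (rule inj_onI)
    fix i j assume "i \<in> {..depth v}" "j \<in> {..depth v}" "(pr ^^ i) v = (pr ^^ j) v"
    then show "i = j"
      using iter_pr[of v i] iter_pr[of v j] assms by auto
  qed
  then have "card {..depth v} \<le> card V"
    using iter_pr[OF assms] finite_V by (intro card_inj_on_le) auto
  then show ?thesis
    by simp
qed

text \<open>Bottom-up induction; leaves need no base case, having no children. The measure
  \<open>ht - depth v\<close> drops from a vertex to its children because the height bounds all
  depths.\<close>

lemma leaf_induct [consumes 1, case_names step]:
  assumes "v \<in> V"
    and step: "\<And>v. v \<in> V \<Longrightarrow> (\<And>c. c \<in> children v \<Longrightarrow> P c) \<Longrightarrow> P v"
  shows "P v"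
  using assms(1)
proof (induction "ht - depth v" arbitrary: v rule: less_induct)
  case less
  show ?case
  proof (rule step)
    fix c assume c: "c \<in> children v"
    then have "ht - depth c < ht - depth v"
      using depth_child[of c v] depth_le_ht[of c] children_V[of c v] by auto
    then show "P c"
      using less.hyps c children_V by blast
  qed (fact less.prems)
qed

end

section \<open>Auxiliary facts on connectivity and extended naturals\<close>

lemma rtrancl_leaves:
  assumes "(a, b) \<in> R\<^sup>*" "a \<in> S" "b \<notin> S"
  shows "\<exists>c d. (c, d) \<in> R \<and> c \<in> S \<and> d \<notin> S"
  using assms by (induction rule: rtrancl_induct) auto

lemma graph_connected_mono: "graph_connected V E \<Longrightarrow> E \<subseteq> F \<Longrightarrow> graph_connected V F"
  using rtrancl_mono[of "adj E" "adj F"] unfolding graph_connected_def adj_def by blast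

lemma graph_connected_star:
  assumes "\<And>v. v \<in> V \<Longrightarrow> (v, r) \<in> (adj E)\<^sup>*"
  shows "graph_connected V E"
proof -
  have "sym ((adj E)\<^sup>*)"
    by (intro sym_rtrancl symI) (simp add: adj_def insert_commute)
  then show ?thesis
    unfolding graph_connected_def using assms by (meson rtrancl_trans symD)
qed

text \<open>The order is a well-order, so only the empty set lacks a minimum, and its infimum is
  infinite.\<close>

lemma Inf_enat_attained:
  assumes "(INF u\<in>A. f u) \<noteq> (\<infinity>::enat)"
  shows "\<exists>u\<in>A. f u = (INF u\<in>A. f u)"
proof -
  have "f ` A \<noteq> {}"
    using assms by (auto simp: Inf_enat_def)
  then have "Inf (f ` A) \<in> f ` A"
    unfolding Inf_enat_def by (auto intro: LeastI)
  then show ?thesis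
    by auto
qed

lemma sum_UNION_le:
  fixes f :: "'a \<Rightarrow> enat"
  assumes "finite I" "\<And>i. i \<in> I \<Longrightarrow> finite (A i)"
  shows "sum f (\<Union>i\<in>I. A i) \<le> (\<Sum>i\<in>I. sum f (A i))"
  using assms
proof (induction I rule: finite_induct)
  case (insert i I)
  let ?U = "\<Union>i\<in>I. A i"
  have "sum f (A i \<union> ?U) = sum f (A i) + sum f (?U - A i)"
    using insert by (subst sum.union_disjoint[symmetric]) auto
  also have "\<dots> \<le> sum f (A i) + sum f ?U"
    using insert by (intro add_left_mono sum_mono2) auto
  also have "\<dots> \<le> sum f (A i) + (\<Sum>i\<in>I. sum f (A i))"
    using insert by (intro add_left_mono) auto
  finally show ?case
    using insert by simp
qed simp

lemma enat_diff_left_mono: "a \<le> b \<Longrightarrow> a - c \<le> b - (c::enat)"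
  by (cases a; cases b; cases c) auto

text \<open>This holds at infinity too, as \<open>\<infinity> - \<infinity> = \<infinity>\<close>,
  so it can be applied before any price is known to be finite.\<close>

lemma enat_diff_add: "c \<le> a \<Longrightarrow> a - c + c = (a::enat)"
  by (cases a; cases c) auto

section \<open>Covering the tree edges\<close>

context rooted_tree
begin

text \<open>Deleting the parent edge of \<open>x\<close> splits the tree into the subtree of
  \<open>x\<close> and the rest. The graph stays connected exactly if a non-tree edge of
  \<open>Aug\<close> has one endpoint on each side.\<close>

lemma augmentation_iff:
  "augmentation V E T Aug \<longleftrightarrow>
     Aug \<subseteq> E \<and> (\<forall>x\<in>V - {r}. \<exists>a b. {a, b} \<in> Aug - T \<and> x \<in> ancestors a \<and> x \<notin> ancestors b)"
  (is "_ \<longleftrightarrow> _ \<and> ?cov")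
proof (intro iffI conjI ballI)
  fix x assume aug: "augmentation V E T Aug" and x: "x \<in> V - {r}"
  define e where "e = {pr x, x}"
  have e: "e \<in> T"
    unfolding e_def using x pr_edge by simp
  then have "graph_connected V (T \<union> Aug - {e})"
    using aug by (simp add: augmentation_def two_edge_connected_def)
  then have "(x, r) \<in> (adj (T \<union> Aug - {e}))\<^sup>*"
    using x root_in_V by (simp add: graph_connected_def)
  \<comment> \<open>The subtree of \<open>x\<close> contains \<open>x\<close> but not
    \<open>r\<close>, so a walk from \<open>x\<close> to \<open>r\<close> crosses its boundary; the
    only tree edge doing so is \<open>e\<close>.\<close>
  then have "\<exists>c d. (c, d) \<in> adj (T \<union> Aug - {e}) \<and> c \<in> {y. x \<in> ancestors y} \<and> d \<notin> {y. x \<in> ancestors y}"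
    by (rule rtrancl_leaves) (use x self_ancestor ancestors_root in auto)
  then obtain a b where ab: "{a, b} \<in> T \<union> Aug" "{a, b} \<noteq> e" "x \<in> ancestors a" "x \<notin> ancestors b"
    by (auto simp: adj_def)
  have "{a, b} \<notin> T"
  proof
    assume T: "{a, b} \<in> T"
    then have V: "a \<in> V" "b \<in> V"
      using T_sub_E edge_V by blast+
    from tree_edge_cases[OF T] show False
    proof
      assume "a \<noteq> r \<and> pr a = b"
      then have "x = a"
        using ancestors_eq[of a] V ab by auto
      then show False
        using ab \<open>a \<noteq> r \<and> pr a = b\<close> by (auto simp: e_def insert_commute)
    next
      assume "b \<noteq> r \<and> pr b = a"
      then show False
        using ancestors_eq[of b] V ab by auto
    qed
  qed
  then show "\<exists>a b. {a, b} \<in> Aug - T \<and> x \<in> ancestors a \<and> x \<notin> ancestors b"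
    using ab by blast
next
  assume "augmentation V E T Aug"
  then show "Aug \<subseteq> E"
    by (simp add: augmentation_def)
next
  assume asm: "Aug \<subseteq> E \<and> ?cov"
  have "graph_connected V (T \<union> Aug - {e})" if "e \<in> T \<union> Aug" for e
  proof (cases "e \<in> T")
    case False
    then have "T \<subseteq> T \<union> Aug - {e}"
      by auto
    then show ?thesis
      by (rule graph_connected_mono[OF T_connected])
  next
    case True
    \<comment> \<open>All parent edges but \<open>e\<close> survive in \<open>F\<close>. Climbing
      them leads from the subtree of \<open>x\<close> to \<open>x\<close> and from elsewhere to
      \<open>r\<close>; the edge \<open>{a, b}\<close> joins the two parts.\<close>
    define F where "F = T \<union> Aug - {e}"
    from True T_sub_E obtain a b where "e = {a, b}" "{a, b} \<in> T"
      using edge_E_cases by (metis subsetD)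
    then obtain x where x: "x \<in> V" "x \<noteq> r" and e: "e = {pr x, x}"
      using tree_edge_cases[of a b] edge_V[of a b] T_sub_E by (auto simp: insert_commute)
    obtain a b where ab: "{a, b} \<in> Aug - T" "x \<in> ancestors a" "x \<notin> ancestors b"
      using asm x by blast
    have abV: "a \<in> V" "b \<in> V"
      using ab(1) asm edge_V by blast+
    have parent_step: "(y, pr y) \<in> adj F" if "y \<in> V" "y \<noteq> r" "y \<noteq> x" for y
    proof -
      have "{pr y, y} \<noteq> e"
        using e that depth_pr[OF x] depth_pr[OF that(1,2)] by (auto simp: doubleton_eq_iff)
      then show ?thesis
        using pr_edge[OF that(1,2)] by (auto simp: F_def adj_def insert_commute)
    qed
    have to_x: "x \<in> ancestors y \<longrightarrow> (y, x) \<in> (adj F)\<^sup>*"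
      and to_r: "x \<notin> ancestors y \<longrightarrow> (y, r) \<in> (adj F)\<^sup>*" if "y \<in> V" for y
      using that
    proof (induction "depth y" arbitrary: y)
      case 0
      { case 1 then show ?case using depth_eq_0[of y] 0 x by (auto simp: ancestors_root) }
      { case 2 then show ?case using depth_eq_0[of y] 0 by auto }
    next
      case (Suc n)
      have y: "y \<noteq> r" "n = depth (pr y)" if "y \<in> V"
        using Suc.hyps(3) depth_eq_0[OF that] depth_pr[OF that] by auto
      { case 1
        show ?case
        proof (cases "y = x")
          case False
          then show ?thesis
            using parent_step[OF 1 y(1)[OF 1]] Suc.hyps(1)[OF y(2)[OF 1] pr_V[OF 1 y(1)[OF 1]]]
              ancestors_eq[OF 1 y(1)[OF 1]] by (auto intro: converse_rtrancl_into_rtrancl)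
        qed simp }
      { case 2
        have "x \<notin> ancestors y \<longrightarrow> y \<noteq> x"
          using self_ancestor by auto
        then show ?case
          using parent_step[OF 2 y(1)[OF 2]] Suc.hyps(2)[OF y(2)[OF 2] pr_V[OF 2 y(1)[OF 2]]]
            ancestors_eq[OF 2 y(1)[OF 2]] by (auto intro: converse_rtrancl_into_rtrancl) }
    qed
    have "sym ((adj F)\<^sup>*)"
      by (intro sym_rtrancl symI) (simp add: adj_def insert_commute)
    then have "(x, a) \<in> (adj F)\<^sup>*"
      using to_x abV ab by (meson symD)
    moreover have "(a, b) \<in> adj F"
      using ab True by (auto simp: F_def adj_def)
    ultimately have "(x, r) \<in> (adj F)\<^sup>*"
      using to_r[of b] abV ab by (meson rtrancl.rtrancl_into_rtrancl rtrancl_trans)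
    then have "(y, r) \<in> (adj F)\<^sup>*" if "y \<in> V" for y
      using to_r[OF that] to_x[OF that] by (meson rtrancl_trans)
    then show ?thesis
      unfolding F_def by (rule graph_connected_star)
  qed
  then show "augmentation V E T Aug"
    unfolding augmentation_def two_edge_connected_def
    using asm graph_connected_mono[OF T_connected, of "T \<union> Aug"] by simp
qed

section \<open>Non-tree edges and the upward paths that they cover\<close>

definition links :: "nat \<Rightarrow> nat set" where
  "links v = {u. {v, u} \<in> E - T}"

text \<open>\<open>reach v j\<close> are the non-tree edges at \<open>v\<close> that cover the whole tree path from \<open>v\<close> up to its
  ancestor at depth \<open>j\<close>: they leave the subtree of the ancestor at depth \<open>j + 1\<close>.\<close>

definition reach :: "nat \<Rightarrow> nat \<Rightarrow> nat set" where
  "reach v j = {u \<in> links v. (pr ^^ (depth v - Suc j)) v \<notin> ancestors u}"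

lemma links_V: "u \<in> links v \<Longrightarrow> u \<in> V \<and> v \<in> V"
  unfolding links_def using edge_V[of v u] by auto

lemma reach_links: "u \<in> reach v j \<Longrightarrow> u \<in> links v"
  by (simp add: reach_def)

lemma links_not_children: "u \<in> links v \<Longrightarrow> u \<notin> children v"
  unfolding links_def using child_edge[of u v] by auto

text \<open>The ancestor at depth \<open>j + 1\<close> has the larger subtree, and whatever leaves
  it also leaves the smaller one at depth \<open>j' + 1\<close>.\<close>

lemma reach_mono:
  assumes "v \<in> V" "j \<le> j'" "j' < depth v"
  shows "reach v j \<subseteq> reach v j'"
proof
  fix u assume u: "u \<in> reach v j"
  have "(pr ^^ (depth v - Suc j)) v \<in> ancestors ((pr ^^ (depth v - Suc j')) v)"
    by (rule ancestor_of_iter) (use assms in auto)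
  then show "u \<in> reach v j'"
    using u links_V[of u v] ancestors_trans[of u] by (auto simp: reach_def)
qed

end

text \<open>\<open>g v j\<close> is the cheapest price at which the tree path from \<open>v\<close> up to depth \<open>j\<close> can be
  covered from the subtree of \<open>v\<close>, where \<open>y c\<close> has already been paid for each edge strictly below
  \<open>v\<close>; the \<open>y\<close> are the dual variables of the covering problem.\<close>

locale reduced_weights = rooted_tree +
  fixes w :: "nat set \<Rightarrow> nat" and g :: "nat \<Rightarrow> nat \<Rightarrow> enat"
  assumes g_rec: "v \<in> V \<Longrightarrow> j < depth v \<Longrightarrow>
    g v j = (INF u\<in>reach v j \<union> children v.
               if u \<in> children v then g u j - g u (depth v) else enat (w {v, u}))"
begin

definition y :: "nat \<Rightarrow> enat" where
  "y x = g x (depth x - 1)"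

lemma g_le_child:
  assumes "c \<in> children v" "v \<in> V" "j < depth v"
  shows "g v j \<le> g c j - g c (depth v)"
  unfolding g_rec[OF assms(2,3)] by (rule INF_lower2[of c]) (use assms(1) in auto)

lemma g_le_link:
  assumes "u \<in> reach v j" "v \<in> V" "j < depth v"
  shows "g v j \<le> w {v, u}"
  unfolding g_rec[OF assms(2,3)]
  by (rule INF_lower2[of u]) (use assms(1) links_not_children[OF reach_links] in auto)

text \<open>Every option for the longer path up to \<open>j\<close> is also one for the shorter path
  up to \<open>j'\<close>, at no greater cost. In particular \<open>y c \<le> g c j\<close> for
  \<open>j < depth c\<close>, which makes the truncated subtraction in \<open>g_rec\<close>
  exact.\<close>

lemma g_antimono:
  assumes "v \<in> V" "j \<le> j'" "j' < depth v"
  shows "g v j' \<le> g v j"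
  using assms
proof (induction v arbitrary: j j' rule: leaf_induct)
  case (step v)
  have j: "j < depth v"
    using step.prems by simp
  have "g v j' \<le> (if u \<in> children v then g u j - g u (depth v) else enat (w {v, u}))"
    if u: "u \<in> reach v j \<union> children v" for u
  proof (cases "u \<in> children v")
    case True
    then have "g u j' \<le> g u j"
      using step depth_child[OF True] by auto
    then have "g u j' - g u (depth v) \<le> g u j - g u (depth v)"
      by (rule enat_diff_left_mono)
    then show ?thesis
      using g_le_child[OF True \<open>v \<in> V\<close> step.prems(2)] True by simp
  next
    case False
    then have "u \<in> reach v j'"
      using u reach_mono[OF \<open>v \<in> V\<close> step.prems] by auto
    then show ?thesis
      using g_le_link[OF _ \<open>v \<in> V\<close> step.prems(2)] False by simp
  qed
  then show ?case
    unfolding g_rec[OF \<open>v \<in> V\<close> j] by (intro INF_greatest)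
qed

text \<open>At \<open>v\<close> the price is at most \<open>w {v, u}\<close>, and each step up
  lowers it by at least \<open>y\<close>, since the parent can always take the offer of this
  child.\<close>

lemma telescope:
  assumes v: "v \<in> V" "j < depth v" and u: "u \<in> reach v j" and k: "k \<le> depth v - Suc j"
  shows "g ((pr ^^ k) v) j + (\<Sum>i<k. y ((pr ^^ i) v)) \<le> w {v, u}"
  using k
proof (induction k)
  case 0
  then show ?case
    using g_le_link[OF u v] by simp
next
  case (Suc k)
  let ?x = "(pr ^^ k) v" and ?S = "\<Sum>i<k. y ((pr ^^ i) v)"
  have x: "?x \<in> V" "depth ?x = depth v - k"
    using iter_pr[OF v(1), of k] Suc.prems by auto
  have "?x \<noteq> r"
    using x Suc.prems v(2) depth_root by auto
  then have child: "?x \<in> children (pr ?x)"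
    using x by (simp add: children_def)
  have d: "j < depth (pr ?x)" "depth ?x = Suc (depth (pr ?x))"
    using depth_pr[OF x(1) \<open>?x \<noteq> r\<close>] x Suc.prems v(2) by auto
  have y: "y ?x = g ?x (depth (pr ?x))"
    using d by (simp add: y_def)
  have "g (pr ?x) j \<le> g ?x j - y ?x"
    using g_le_child[OF child pr_V[OF x(1) \<open>?x \<noteq> r\<close>] d(1)] y by simp
  then have "g (pr ?x) j + y ?x \<le> g ?x j"
    using enat_diff_add[of "y ?x" "g ?x j"] g_antimono[OF x(1), of j "depth (pr ?x)"] d y
    by (metis add_right_mono lessI less_imp_le)
  then have "g (pr ?x) j + (?S + y ?x) \<le> g ?x j + ?S"
    using add_right_mono[of _ _ ?S] by (simp add: ac_simps)
  also have "\<dots> \<le> w {v, u}"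
    using Suc by simp
  finally show ?case
    by simp
qed

text \<open>The sum runs along the path from \<open>v\<close> up to the topmost ancestor
  \<open>x\<close> that is not above \<open>u\<close>. With \<open>j = depth x - 1\<close>, the edge
  lies in \<open>reach v j\<close> and \<open>g x j = y x\<close>, so \<open>telescope\<close> at
  \<open>x\<close> bounds the whole sum.\<close>

lemma dual_feasible:
  assumes "u \<in> links v"
  shows "(\<Sum>x\<in>ancestors v - ancestors u. y x) \<le> w {v, u}"
proof (cases "ancestors v - ancestors u = {}")
  case True
  then show ?thesis
    by (simp only: sum.empty zero_le)
next
  case False
  have V: "u \<in> V" "v \<in> V"
    using links_V assms by auto
  obtain x where x: "x \<in> ancestors v - ancestors u"
    and min: "\<And>z. z \<in> ancestors v - ancestors u \<Longrightarrow> depth x \<le> depth z"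
    using False arg_min_nat_le[of _ _ depth] arg_min_natI[of "\<lambda>x. x \<in> ancestors v - ancestors u" _ depth]
    by (metis (no_types, lifting) all_not_in_conv)
  have "x \<in> V"
    using x V ancestors_V by blast
  have "x \<noteq> r"
    using x root_ancestor V by auto
  then obtain j where j: "depth x = Suc j"
    using depth_eq_0[OF \<open>x \<in> V\<close>] not0_implies_Suc by blast
  have dx: "depth x \<le> depth v" and x_iter: "x = (pr ^^ (depth v - Suc j)) v"
    using x V ancestor_depth_le[of v x] ancestor_iter[of v x] j by auto
  then have u: "u \<in> reach v j"
    using assms x by (auto simp: reach_def)
  have "ancestors v - ancestors u \<subseteq> (\<lambda>i. (pr ^^ i) v) ` {..<Suc (depth v - Suc j)}"
  proof
    fix z assume z: "z \<in> ancestors v - ancestors u"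
    then have "z = (pr ^^ (depth v - depth z)) v"
      using ancestor_iter V by blast
    then show "z \<in> (\<lambda>i. (pr ^^ i) v) ` {..<Suc (depth v - Suc j)}"
      using min[OF z] j by (intro image_eqI[of _ _ "depth v - depth z"]) auto
  qed
  then have "(\<Sum>x\<in>ancestors v - ancestors u. y x) \<le>
      (\<Sum>x\<in>(\<lambda>i. (pr ^^ i) v) ` {..<Suc (depth v - Suc j)}. y x)"
    by (intro sum_mono2) auto
  also have "\<dots> \<le> (\<Sum>i<Suc (depth v - Suc j). y ((pr ^^ i) v))"
    using sum_image_le[of "{..<Suc (depth v - Suc j)}" y "\<lambda>i. (pr ^^ i) v"] by (simp add: o_def)
  also have "\<dots> = g x j + (\<Sum>i<depth v - Suc j. y ((pr ^^ i) v))"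
    using j by (simp add: y_def add.commute flip: x_iter)
  also have "\<dots> \<le> w {v, u}"
    using telescope[OF V(2) _ u, of "depth v - Suc j"] dx j x_iter by simp
  finally show ?thesis .
qed

text \<open>The factor 2: an edge covers one upward path from each of its endpoints.\<close>

lemma weak_duality:
  assumes "augmentation V E T Aug"
  shows "(\<Sum>x\<in>V - {r}. y x) \<le> 2 * sum w Aug"
proof -
  \<comment> \<open>\<open>cut e\<close> contains the vertices whose parent edge is covered by
    \<open>e\<close>; the quantifiers allow both orientations of \<open>e\<close>.\<close>
  define cut where "cut e = {x \<in> V - {r}. \<exists>a b. e = {a, b} \<and> x \<in> ancestors a \<and> x \<notin> ancestors b}" for e
  have Aug: "Aug \<subseteq> E" and cov: "\<And>x. x \<in> V - {r} \<Longrightarrow> \<exists>e\<in>Aug - T. x \<in> cut e"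
    using assms unfolding augmentation_iff cut_def by blast+
  have fin: "finite Aug"
    using Aug finite_E finite_subset by blast
  have cut_le: "(\<Sum>x\<in>cut e. y x) \<le> 2 * enat (w e)" if "e \<in> Aug - T" for e
  proof -
    have "e \<in> E"
      using that Aug by auto
    then obtain a b where e: "e = {a, b}"
      by (rule edge_E_cases)
    have "cut e \<subseteq> (ancestors a - ancestors b) \<union> (ancestors b - ancestors a)"
      by (auto simp: cut_def e doubleton_eq_iff)
    then have "(\<Sum>x\<in>cut e. y x) \<le> (\<Sum>x\<in>(ancestors a - ancestors b) \<union> (ancestors b - ancestors a). y x)"
      by (intro sum_mono2) (auto simp: finite_ancestors)
    also have "\<dots> = (\<Sum>x\<in>ancestors a - ancestors b. y x) + (\<Sum>x\<in>ancestors b - ancestors a. y x)"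
      by (intro sum.union_disjoint) (auto simp: finite_ancestors)
    also have "\<dots> \<le> enat (w {a, b}) + enat (w {b, a})"
      by (intro add_mono dual_feasible) (use that Aug e in \<open>auto simp: links_def insert_commute\<close>)
    finally show ?thesis
      by (simp add: e insert_commute mult_2)
  qed
  have "(\<Sum>x\<in>V - {r}. y x) \<le> (\<Sum>x\<in>(\<Union>e\<in>Aug - T. cut e). y x)"
    by (rule sum_mono2) (use cov fin finite_V in \<open>auto simp: cut_def\<close>)
  also have "\<dots> \<le> (\<Sum>e\<in>Aug - T. \<Sum>x\<in>cut e. y x)"
    using fin by (intro sum_UNION_le) (auto simp: cut_def finite_V)
  also have "\<dots> \<le> (\<Sum>e\<in>Aug - T. 2 * enat (w e))"
    by (intro sum_mono cut_le)
  also have "\<dots> \<le> (\<Sum>e\<in>Aug. 2 * enat (w e))"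
    using fin by (intro sum_mono2) auto
  also have "\<dots> = enat (2 * sum w Aug)"
    using fin by (induction Aug rule: finite_induct)
      (auto simp: numeral_eq_enat zero_enat_def algebra_simps)
  finally show ?thesis .
qed

text \<open>\<open>E\<close> itself is an augmentation, so weak duality bounds the sum by a finite
  number. Prices of longer paths may well be infinite.\<close>

lemma y_finite:
  assumes "x \<in> V" "x \<noteq> r"
  shows "y x \<noteq> \<infinity>"
proof -
  have "augmentation V E T E"
    using E_2ec T_sub_E by (simp add: augmentation_def sup.absorb2)
  from weak_duality[OF this] have "(\<Sum>x\<in>V - {r}. y x) \<noteq> \<infinity>"
    by (metis infinity_ileE)
  moreover have "y x \<le> (\<Sum>x\<in>V - {r}. y x)"
    using assms finite_V by (intro member_le_sum) auto
  ultimately show ?thesis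
    by (metis enat_ord_simps(5))
qed

text \<open>Following minimisers down the tree ends at a non-tree edge, and subtractions on the way
  only lower its weight. This keeps the messages short.\<close>

lemma g_bounded:
  assumes "v \<in> V" "j < depth v" "g v j \<noteq> \<infinity>"
  shows "\<exists>e\<in>E. g v j \<le> w e"
  using assms
proof (induction v arbitrary: j rule: leaf_induct)
  case (step v)
  obtain u where u: "u \<in> reach v j \<union> children v"
    and eq: "(if u \<in> children v then g u j - g u (depth v) else enat (w {v, u})) = g v j"
    using Inf_enat_attained[of _ "reach v j \<union> children v"] step.prems
    unfolding g_rec[OF \<open>v \<in> V\<close> step.prems(1)] by blast
  show ?case
  proof (cases "u \<in> children v")
    case True
    then have eq: "g v j = g u j - g u (depth v)"
      using eq by simp
    then have "g u j \<noteq> \<infinity>"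
      using step.prems by (metis idiff_infinity)
    then obtain e where "e \<in> E" "g u j \<le> w e"
      using step.IH[OF True, of j] step.prems depth_child[OF True] by auto
    moreover have "g v j \<le> g u j"
      unfolding eq by (cases "g u j"; cases "g u (depth v)") auto
    ultimately show ?thesis
      using order_trans by blast
  next
    case False
    then have "{v, u} \<in> E" "g v j = w {v, u}"
      using u eq by (auto simp: reach_def links_def)
    then show ?thesis
      by auto
  qed
qed

end

section \<open>Tracing back an optimal choice\<close>

text \<open>Following minimisers from the root down, a vertex \<open>v\<close> has to see to it that the path from \<open>v\<close>
  up to depth \<open>dm v\<close> gets covered from its subtree: either by its own non-tree edge to \<open>ch v\<close>, or
  by passing the demand on to its child \<open>ch v\<close>.\<close>

locale traceback = reduced_weights +
  fixes ch dm :: "nat \<Rightarrow> nat"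
  assumes demand: "v \<in> V - {r} \<Longrightarrow>
      dm v = (if pr v \<noteq> r \<and> ch (pr v) = v then dm (pr v) else depth v - 1)"
    and choice: "v \<in> V - {r} \<Longrightarrow> g v (dm v) \<noteq> \<infinity> \<Longrightarrow>
      ch v \<in> reach v (dm v) \<union> children v \<and>
      (if ch v \<in> children v then g (ch v) (dm v) - g (ch v) (depth v) else enat (w {v, ch v})) =
        g v (dm v)"
begin

definition selected :: "nat set set" where
  "selected = {{v, ch v} | v. v \<in> V - {r} \<and> ch v \<notin> children v}"

text \<open>A fresh demand costs \<open>y v\<close>, which is finite. For an inherited one, the
  finite price of the parent is the offer of \<open>v\<close>, and an infinite price of
  \<open>v\<close> would make this offer infinite. Finiteness is what makes \<open>choice\<close>
  applicable.\<close>

lemma demand_less_and_finite: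
  assumes "v \<in> V - {r}"
  shows "dm v < depth v \<and> g v (dm v) \<noteq> \<infinity>"
  using assms
proof (induction "depth v" arbitrary: v rule: less_induct)
  case less
  then have v: "v \<in> V" "v \<noteq> r" and pos: "depth v \<noteq> 0"
    using depth_eq_0 by auto
  have child: "v \<in> children (pr v)"
    using v by (simp add: children_def)
  show ?case
  proof (cases "pr v \<noteq> r \<and> ch (pr v) = v")
    case True
    then have p: "pr v \<in> V - {r}" and dm: "dm v = dm (pr v)"
      using v pr_V demand[OF less.prems] by auto
    have IH: "dm (pr v) < depth (pr v)" "g (pr v) (dm (pr v)) \<noteq> \<infinity>"
      using less.hyps[OF _ p] depth_pr[OF v] by auto
    then have "g v (dm v) - g v (depth (pr v)) = g (pr v) (dm (pr v))"
      using choice[OF p] True child dm by auto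
    then have "g v (dm v) \<noteq> \<infinity>"
      using IH by (metis idiff_infinity)
    then show ?thesis
      using IH dm depth_pr[OF v] by simp
  next
    case False
    then have "dm v = depth v - 1"
      using demand[OF less.prems] by auto
    then show ?thesis
      using y_finite[OF v] pos by (simp add: y_def)
  qed
qed

lemma choice_valid:
  assumes "v \<in> V - {r}"
  shows "ch v \<in> reach v (dm v) \<union> children v"
    and "ch v \<in> children v \<Longrightarrow> g (ch v) (dm v) - g (ch v) (depth v) = g v (dm v)"
    and "ch v \<notin> children v \<Longrightarrow> enat (w {v, ch v}) = g v (dm v)"
  using choice[OF assms] demand_less_and_finite[OF assms] by auto

lemma choice_V: "v \<in> V - {r} \<Longrightarrow> ch v \<in> V"
  using choice_valid(1)[of v] links_V[of "ch v" v] reach_links[of "ch v" v] children_V[of "ch v" v] by auto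

lemma selected_sub: "selected \<subseteq> E - T"
  using choice_valid(1) by (fastforce simp: selected_def reach_def links_def)

text \<open>The demand of \<open>v\<close> passes unchanged along chosen children until some vertex
  meets it with a non-tree edge of its own.\<close>

lemma ex_selected_below:
  assumes "v \<in> V" "v \<noteq> r"
  shows "\<exists>z\<in>V - {r}. v \<in> ancestors z \<and> ch z \<notin> children z \<and> dm z = dm v"
  using assms
proof (induction rule: leaf_induct)
  case (step v)
  show ?case
  proof (cases "ch v \<in> children v")
    case True
    then have c: "ch v \<in> V" "ch v \<noteq> r" "pr (ch v) = v"
      using children_V by auto
    then have "dm (ch v) = dm v"
      using demand[of "ch v"] step.prems by simp
    then obtain z where "z \<in> V - {r}" "ch v \<in> ancestors z" "ch z \<notin> children z" "dm z = dm v"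
      using step.IH[OF True c(2)] by auto
    then show ?thesis
      using ancestors_trans[of z v "ch v"] child_ancestors[OF True] by auto
  next
    case False
    then show ?thesis
      using step self_ancestor by auto
  qed
qed

lemma selected_augmentation: "augmentation V E T selected"
  unfolding augmentation_iff
proof (intro conjI ballI)
  show "selected \<subseteq> E"
    using selected_sub by auto
  fix x assume x: "x \<in> V - {r}"
  then obtain z where z: "z \<in> V - {r}" "x \<in> ancestors z" "ch z \<notin> children z" "dm z = dm x"
    using ex_selected_below by auto
  \<comment> \<open>\<open>t\<close> is the ancestor of \<open>z\<close> at depth
    \<open>dm z + 1\<close>, whose subtree the edge chosen by \<open>z\<close> leaves. As
    \<open>dm z = dm x < depth x\<close>, it is also an ancestor of \<open>x\<close>, so the edge
    leaves the subtree of \<open>x\<close> as well.\<close>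
  define t where "t = (pr ^^ (depth z - Suc (dm z))) z"
  have "ch z \<in> reach z (dm z)"
    using choice_valid(1)[OF z(1)] z(3) by auto
  then have t: "t \<notin> ancestors (ch z)"
    by (simp add: reach_def t_def)
  have "t \<in> ancestors z" "depth t = Suc (dm z)"
    unfolding t_def using iter_ancestor[of _ z] iter_pr[of z] z demand_less_and_finite[OF z(1)] by auto
  then have "t \<in> ancestors x"
    using ancestor_linear[of z t x] z demand_less_and_finite[OF x] by auto
  then have "x \<notin> ancestors (ch z)"
    using t ancestors_trans[OF choice_V[OF z(1)]] by auto
  moreover have "{z, ch z} \<in> selected - T"
    using z selected_sub by (auto simp: selected_def)
  ultimately show "\<exists>a b. {a, b} \<in> selected - T \<and> x \<in> ancestors a \<and> x \<notin> ancestors b"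
    using z(2) by blast
qed

lemma sum_children: "(\<Sum>v\<in>V. \<Sum>c\<in>children v. f c) = (\<Sum>c\<in>V - {r}. f c)"
  unfolding children_def by (rule sum.group) (use finite_V pr_V in auto)

text \<open>Complementary slackness: at every vertex, the price \<open>D v\<close> of its demand and the dual variables
  of its children pay for its own edge and for the demands of its children.\<close>

lemma weight_selected: "enat (sum w selected) \<le> (\<Sum>x\<in>V - {r}. y x)"
proof -
  define D where "D v = g v (dm v)" for v
  define cost where "cost v = (if v = r \<or> ch v \<in> children v then 0 else enat (w {v, ch v}))" for v
  define D' where "D' v = (if v = r then 0 else D v)" for v
  have local: "cost v + (\<Sum>c\<in>children v. D c) = D' v + (\<Sum>c\<in>children v. y c)" if v: "v \<in> V" for v
  proof -
    \<comment> \<open>A child of the root, or one that its parent does not choose, has only its own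
      parent edge as demand.\<close>
    have D_y: "D c = y c" if "c \<in> children v" "v = r \<or> ch v \<noteq> c" for c
      using that demand[of c] children_V[of c v] by (auto simp: D_def y_def)
    show ?thesis
    proof (cases "v = r \<or> ch v \<notin> children v")
      case True
      then have "(\<Sum>c\<in>children v. D c) = (\<Sum>c\<in>children v. y c)"
        using D_y by (intro sum.cong) auto
      then show ?thesis
        using True choice_valid(3)[of v] v by (auto simp: cost_def D'_def D_def)
    next
      case False
      let ?c = "ch v"
      have c: "?c \<in> children v" and vr: "v \<in> V - {r}"
        using False v by auto
      then have dm: "dm ?c = dm v"
        using demand[of ?c] children_V[OF c] by auto
      have "y ?c \<le> D ?c"
        unfolding y_def D_def
        using demand_less_and_finite[OF vr] dm depth_child[OF c] children_V[OF c]
        by (intro g_antimono) auto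
      moreover have "D ?c - y ?c = D v"
        using choice_valid(2)[OF vr c] dm depth_child[OF c] by (simp add: D_def y_def)
      ultimately have *: "D ?c = D v + y ?c"
        using enat_diff_add by metis
      have fin: "finite (children v)"
        using finite_V by (simp add: children_def)
      have "(\<Sum>x\<in>children v - {?c}. D x) = (\<Sum>x\<in>children v - {?c}. y x)"
        using D_y by (intro sum.cong) auto
      then show ?thesis
        using sum.remove[OF fin c, of D] sum.remove[OF fin c, of y] * False
        by (simp add: cost_def D'_def ac_simps)
    qed
  qed
  have "(\<Sum>v\<in>V. cost v) + (\<Sum>v\<in>V - {r}. D v) = (\<Sum>v\<in>V. D' v) + (\<Sum>v\<in>V - {r}. y v)"
    unfolding sum_children[symmetric] sum.distrib[symmetric] using local by (intro sum.cong) auto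
  moreover have "(\<Sum>v\<in>V. D' v) = (\<Sum>v\<in>V - {r}. D v)"
    using finite_V root_in_V by (subst sum.remove[of _ r]) (auto simp: D'_def)
  \<comment> \<open>Only a finite sum can be cancelled in \<open>enat\<close>.\<close>
  moreover have "(\<Sum>v\<in>V - {r}. D v) \<noteq> \<infinity>"
  proof -
    have "sum D A \<noteq> \<infinity>" if "finite A" "A \<subseteq> V - {r}" for A
      using that demand_less_and_finite by (induction A rule: finite_induct) (auto simp: D_def plus_eq_infty_iff_enat simp del: not_infinity_eq)
    then show ?thesis
      using finite_V by simp
  qed
  ultimately have total: "(\<Sum>v\<in>V. cost v) = (\<Sum>v\<in>V - {r}. y v)"
    by (metis add.commute enat_add_left_cancel)
  define S where "S = {v \<in> V - {r}. ch v \<notin> children v}"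
  have "selected = (\<lambda>v. {v, ch v}) ` S"
    by (auto simp: selected_def S_def)
  \<comment> \<open>This may be strict: both endpoints of an edge can choose it.\<close>
  then have "sum w selected \<le> (\<Sum>v\<in>S. w {v, ch v})"
    using sum_image_le[of S w "\<lambda>v. {v, ch v}"] finite_V by (simp add: S_def o_def)
  then have "enat (sum w selected) \<le> enat (\<Sum>v\<in>S. w {v, ch v})"
    by simp
  also have "\<dots> = (\<Sum>v\<in>S. enat (w {v, ch v}))"
    by (simp flip: of_nat_eq_enat)
  also have "\<dots> = (\<Sum>v\<in>S. cost v)"
    by (intro sum.cong) (auto simp: S_def cost_def)
  also have "\<dots> \<le> (\<Sum>v\<in>V. cost v)"
    using finite_V by (intro sum_mono2) (auto simp: S_def)
  finally show ?thesis
    unfolding total .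
qed

lemma selected_2_approx: "augmentation V E T Aug \<Longrightarrow> sum w selected \<le> 2 * sum w Aug"
  using order_trans[OF weight_selected weak_duality] by simp

text \<open>The form in which \<open>v\<close> learns its output: from its own choice and from those
  announced by its neighbours.\<close>

lemma selected_nbrs:
  assumes "v \<in> V"
  shows "{u. {v, u} \<in> selected} = {u \<in> links v. v \<noteq> r \<and> ch v = u \<or> u \<noteq> r \<and> ch u = v}"
proof (intro set_eqI iffI)
  fix u assume "u \<in> {u. {v, u} \<in> selected}"
  then have sel: "{v, u} \<in> selected"
    by simp
  then have "u \<in> links v"
    using selected_sub by (auto simp: links_def)
  then show "u \<in> {u \<in> links v. v \<noteq> r \<and> ch v = u \<or> u \<noteq> r \<and> ch u = v}"
    using sel by (auto simp: selected_def doubleton_eq_iff)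
next
  fix u assume "u \<in> {u \<in> links v. v \<noteq> r \<and> ch v = u \<or> u \<noteq> r \<and> ch u = v}"
  then have u: "u \<in> links v" "v \<noteq> r \<and> ch v = u \<or> u \<noteq> r \<and> ch u = v"
    by auto
  then have "v \<in> links u"
    by (simp add: links_def insert_commute)
  then have "u \<notin> children v" "v \<notin> children u" "u \<in> V"
    using u links_not_children links_V by auto
  then have "{v, u} \<in> selected"
    using u(2) assms unfolding selected_def by (auto simp: insert_commute)
  then show "u \<in> {u. {v, u} \<in> selected}"
    by simp
qed

end

section \<open>The algorithm\<close>

text \<open>Ancestors, height and choice are shifted by one, so that 0 marks their absence; price 0
  also stands for infinity. The demand is meaningful only beside a nonzero choice.\<close>

record msg =
  m_anc :: nat
  m_done :: nat
  m_height :: nat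
  m_price :: nat
  m_choice :: nat
  m_demand :: nat

text \<open>The bits are interleaved with continuation marks, which makes the code prefix-free.\<close>

fun encode_nat :: "nat \<Rightarrow> bool list" where
  "encode_nat n = (if n = 0 then [False] else True # odd n # encode_nat (n div 2))"

declare encode_nat.simps [simp del]

text \<open>The remainders \<open>xs\<close> and \<open>ys\<close> allow rewriting to strip the
  fields of \<open>encode\<close> one by one, which is why \<open>encode\<close> ends in
  \<open>@ []\<close>.\<close>

lemma encode_nat_prefix_free:
  "encode_nat m @ xs = encode_nat n @ ys \<longleftrightarrow> m = n \<and> xs = ys"
proof (induction m arbitrary: n rule: less_induct)
  case (less m)
  show ?case
  proof (cases "m = 0 \<or> n = 0")
    case True
    then show ?thesis
      by (subst (1 2) encode_nat.simps) auto
  next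
    case False
    then have "encode_nat m @ xs = encode_nat n @ ys \<longleftrightarrow>
        odd m = odd n \<and> m div 2 = n div 2 \<and> xs = ys"
      using less.IH[of "m div 2" "n div 2"] by (subst (1 2) encode_nat.simps) auto
    also have "odd m = odd n \<and> m div 2 = n div 2 \<longleftrightarrow> m = n"
      by (metis div_mult_mod_eq even_iff_mod_2_eq_zero not_mod_2_eq_0_eq_1)
    ultimately show ?thesis
      by auto
  qed
qed

text \<open>Each binary digit takes two bits, and the terminator one.\<close>

lemma length_encode_nat:
  assumes "n > 0"
  shows "real (length (encode_nat n)) \<le> 3 + 2 * log 2 (real n)"
  using assms
proof (induction n rule: less_induct)
  case (less n)
  show ?case
  proof (cases "n = 1")
    case True
    then show ?thesis
      by (simp add: encode_nat.simps)
  next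
    case False
    then have n: "n \<ge> 2"
      using less.prems by simp
    then have "real (length (encode_nat (n div 2))) \<le> 3 + 2 * log 2 (real (n div 2))"
      using less.IH[of "n div 2"] by simp
    also have "log 2 (real (n div 2)) \<le> log 2 (real n / 2)"
    proof -
      have "real (n div 2) \<le> real n / 2"
        using of_nat_mono[of "2 * (n div 2)" n, where 'a = real] by simp
      moreover have "0 < n div 2"
        using n by (simp add: div_greater_zero_iff)
      ultimately show ?thesis
        using n by (subst log_le_cancel_iff) auto
    qed
    also have "log 2 (real n / 2) = log 2 (real n) - 1"
      using n by (simp add: log_divide)
    finally show ?thesis
      using n by (subst encode_nat.simps) simp
  qed
qed

definition encode :: "msg \<Rightarrow> bool list" where
  "encode m = encode_nat (m_anc m) @ encode_nat (m_done m) @ encode_nat (m_height m) @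
     encode_nat (m_price m) @ encode_nat (m_choice m) @ encode_nat (m_demand m) @ []"

lemma inj_encode: "inj encode"
  by (rule injI) (simp only: encode_def encode_nat_prefix_free, simp)

definition decode :: "bool list \<Rightarrow> msg" where
  "decode = inv encode"

lemma decode_encode: "decode (encode m) = m"
  unfolding decode_def by (rule inv_f_f[OF inj_encode])

definition code_enat :: "enat \<Rightarrow> nat" where
  "code_enat x = (case x of enat n \<Rightarrow> Suc n | \<infinity> \<Rightarrow> 0)"

definition decode_enat :: "nat \<Rightarrow> enat" where
  "decode_enat n = (case n of 0 \<Rightarrow> \<infinity> | Suc n \<Rightarrow> enat n)"

lemma decode_code_enat: "decode_enat (code_enat x) = x"
  by (cases x) (auto simp: code_enat_def decode_enat_def)

text \<open>In the following, \<open>R s u\<close> is the message received from \<open>u\<close> in round \<open>s\<close>.\<close>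

type_synonym received = "nat \<Rightarrow> nat \<Rightarrow> msg"

section \<open>Local computations of a vertex\<close>

definition a_children :: "tap_input \<Rightarrow> nat set" where
  "a_children i = tree_neighbours i - set_option (parent_id i)"

definition a_links :: "tap_input \<Rightarrow> nat set" where
  "a_links i = dom (edge_weights i) - tree_neighbours i"

text \<open>The \<open>s\<close>-th ancestor, shifted by one; \<open>0\<close> if there is none.\<close>

definition a_anc :: "tap_input \<Rightarrow> received \<Rightarrow> nat \<Rightarrow> nat" where
  "a_anc i R s = (if s = 0 then Suc (own_id i)
     else case parent_id i of None \<Rightarrow> 0 | Some p \<Rightarrow> m_anc (R (s - 1) p))"

text \<open>A vertex is done as soon as the clock has reached the height of its subtree. Hence the root
  reads off the height \<open>h\<close> of the tree from its clock, and broadcasts \<open>h + 1\<close>.\<close>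

definition a_done :: "tap_input \<Rightarrow> received \<Rightarrow> nat \<Rightarrow> bool" where
  "a_done i R s \<longleftrightarrow> a_children i = {} \<or> s > 0 \<and> (\<forall>c\<in>a_children i. m_done (R (s - 1) c) \<noteq> 0)"

definition a_height :: "tap_input \<Rightarrow> received \<Rightarrow> nat \<Rightarrow> nat" where
  "a_height i R s = (case parent_id i of
       None \<Rightarrow> if a_done i R s then Suc (LEAST s'. a_done i R s') else 0
     | Some p \<Rightarrow> if s = 0 then 0 else m_height (R (s - 1) p))"

text \<open>A parent at depth \<open>d - 1\<close> runs out of ancestors in round \<open>d\<close>,
  where it sends its first 0.\<close>

definition a_depth :: "tap_input \<Rightarrow> received \<Rightarrow> nat" where
  "a_depth i R = (case parent_id i of None \<Rightarrow> 0 | Some p \<Rightarrow> (LEAST s. m_anc (R s p) = 0))"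

text \<open>The round in which a vertex at depth \<open>d\<close> sends its price for depth \<open>j\<close>: it has then just
  received the last prices this one depends on.\<close>

definition price_time :: "nat \<Rightarrow> nat \<Rightarrow> nat \<Rightarrow> nat" where
  "price_time h d j = 4 * h + 1 - d - j"

definition a_price :: "nat \<Rightarrow> tap_input \<Rightarrow> received \<Rightarrow> nat \<Rightarrow> nat \<Rightarrow> enat" where
  "a_price h i R c j = decode_enat (m_price (R (price_time h (Suc (a_depth i R)) j) c))"

text \<open>A neighbour streams all its ancestors in rounds \<open>0\<close> to \<open>h\<close>.
  The edge to it leaves the subtree of the own ancestor at depth \<open>j + 1\<close> exactly if
  that ancestor is not among them.\<close>

definition a_candidates :: "nat \<Rightarrow> tap_input \<Rightarrow> received \<Rightarrow> nat \<Rightarrow> nat set" where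
  "a_candidates h i R j =
     {u \<in> a_links i. \<forall>s\<le>h. m_anc (R s u) \<noteq> a_anc i R (a_depth i R - Suc j)} \<union> a_children i"

definition a_cost :: "nat \<Rightarrow> tap_input \<Rightarrow> received \<Rightarrow> nat \<Rightarrow> nat \<Rightarrow> enat" where
  "a_cost h i R j u =
     (if u \<in> a_children i then a_price h i R u j - a_price h i R u (a_depth i R)
      else enat (the (edge_weights i u)))"

definition a_min :: "nat \<Rightarrow> tap_input \<Rightarrow> received \<Rightarrow> nat \<Rightarrow> enat" where
  "a_min h i R j = (INF u\<in>a_candidates h i R j. a_cost h i R j u)"

text \<open>The parent, at depth \<open>d - 1\<close>, announces its choice in round \<open>4 * h + 1 + d\<close>.\<close>

definition a_demand :: "nat \<Rightarrow> tap_input \<Rightarrow> received \<Rightarrow> nat" where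
  "a_demand h i R = (case parent_id i of
       None \<Rightarrow> 0
     | Some p \<Rightarrow>
         (let m = R (4 * h + 1 + a_depth i R) p
          in if m_choice m = Suc (own_id i) then m_demand m else a_depth i R - 1))"

text \<open>\<open>SOME\<close> depends only on the predicate, so the choice announced and the one
  recomputed on halting agree.\<close>

definition a_choice :: "nat \<Rightarrow> tap_input \<Rightarrow> received \<Rightarrow> nat" where
  "a_choice h i R = (let j = a_demand h i R in
     SOME u. u \<in> a_candidates h i R j \<and> a_cost h i R j u = a_min h i R j)"

text \<open>The two inequalities guarding the price say that \<open>j = 4 * h + 1 - d - s\<close>
  satisfies \<open>0 \<le> j < d\<close>. Round \<open>2 * h + 2\<close> is the earliest in which a
  price is due (\<open>d = h\<close>, \<open>j = h - 1\<close>); by then all vertices know the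
  height, which reaches depth \<open>d\<close> in round \<open>h + d\<close>.\<close>

definition a_message :: "tap_input \<Rightarrow> received \<Rightarrow> nat \<Rightarrow> msg" where
  "a_message i R s =
     (let h = a_height i R s - 1; d = a_depth i R;
          ready = (a_height i R s \<noteq> 0 \<and> 2 * h + 2 \<le> s);
          decide = (ready \<and> d > 0 \<and> s = 4 * h + 2 + d)
      in \<lparr> m_anc = a_anc i R s,
           m_done = of_bool (a_done i R s),
           m_height = a_height i R s,
           m_price = (if ready \<and> s + d \<le> 4 * h + 1 \<and> 4 * h + 1 < s + 2 * d
                      then code_enat (a_min h i R (4 * h + 1 - d - s)) else 0),
           m_choice = (if decide then Suc (a_choice h i R) else 0),
           m_demand = (if decide then a_demand h i R else 0) \<rparr>)"

text \<open>The deepest vertices announce their choices in round \<open>5 * h + 2\<close>. A vertex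
  without neighbours is alone in the network; there \<open>h = 0\<close>, and it has to halt without
  any round.\<close>

definition a_result :: "tap_input \<Rightarrow> received \<Rightarrow> nat \<Rightarrow> nat set option" where
  "a_result i R s =
     (let h = a_height i R s - 1
      in if edge_weights i = Map.empty then Some {}
         else if a_height i R s \<noteq> 0 \<and> 5 * h + 3 \<le> s
         then Some {u \<in> a_links i. parent_id i \<noteq> None \<and> a_choice h i R = u \<or>
                                   (\<exists>s\<le>5 * h + 2. m_choice (R s u) = Suc (own_id i))}
         else None)"

definition received :: "history \<Rightarrow> received" where
  "received H s u = decode ((H ! s) u)"

definition tap_algorithm :: "(tap_input, nat set) congest_algorithm" where
  "tap_algorithm =
     \<lparr> message = (\<lambda>i H u. encode (a_message i (received H) (length H))),
       result = (\<lambda>i H. a_result i (received H) (length H)) \<rparr>"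

lemma run_halted:
  assumes "result A (I v) (run A E I t v) = Some x" "t \<le> t'"
  shows "result A (I v) (run A E I t' v) = Some x"
  using assms(2,1) by (induction rule: dec_induct) auto

section \<open>The run of the algorithm\<close>

locale tap_network = rooted_tree +
  fixes w :: "nat set \<Rightarrow> nat"
  assumes E_nonempty: "E \<noteq> {}"
begin

abbreviation I :: "nat \<Rightarrow> tap_input" where
  "I \<equiv> local_input E T r w"

abbreviation hist :: "nat \<Rightarrow> nat \<Rightarrow> history" where
  "hist \<equiv> run tap_algorithm E I"

abbreviation rcv :: "nat \<Rightarrow> nat \<Rightarrow> received" where
  "rcv t v \<equiv> received (hist t v)"

definition msg :: "nat \<Rightarrow> nat \<Rightarrow> msg" where
  "msg t v = a_message (I v) (rcv t v) t"

lemma own_id_I [simp]: "own_id (I v) = v"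
  by (simp add: local_input_def)

lemma parent_id_I [simp]: "parent_id (I v) = (if v = r then None else Some (pr v))"
  by (simp add: local_input_def parent_eq) (simp add: parent_def)

lemma a_children_I: "v \<in> V \<Longrightarrow> a_children (I v) = children v"
  unfolding a_children_def using tree_nbrs[of v] pr_not_child[of v] parent_id_I[of v]
  by (auto simp: local_input_def)

lemma a_links_I: "a_links (I v) = links v"
  by (auto simp: a_links_def links_def local_input_def split: if_splits)

lemma ex_neighbour:
  assumes "v \<in> V"
  shows "\<exists>u. {v, u} \<in> E"
proof -
  obtain e where "e \<in> E"
    using E_nonempty by auto
  then obtain a b where "e = {a, b}" "a \<noteq> b"
    by (rule edge_E_cases)
  then obtain u where u: "u \<in> V" "u \<noteq> v"
    using edge_V[of a b] \<open>e \<in> E\<close> by metis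
  have "(v, u) \<in> (adj E)\<^sup>*"
    using E_2ec assms u by (simp add: two_edge_connected_def graph_connected_def)
  then show ?thesis
    using u by (auto elim: converse_rtranclE simp: adj_def)
qed

lemma edge_weights_I: "v \<in> V \<Longrightarrow> edge_weights (I v) \<noteq> Map.empty"
  using ex_neighbour[of v] by (auto simp: local_input_def fun_eq_iff)

lemma ht_pos: "ht > 0"
proof (rule ccontr)
  assume "\<not> ?thesis"
  then have "v = r" if "v \<in> V" for v
    using depth_le_ht[OF that] depth_eq_0[OF that] by simp
  then show False
    using ex_neighbour[OF root_in_V] edge_V[of r] edge_neq[of r] by auto
qed

text \<open>Halting silences a vertex and freezes its history, so clock and messages are reliable
  only before. The lemmas on ancestors and height keep \<open>live t\<close> as a premise because
  \<open>live_halt\<close> is derived from them.\<close>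

definition live :: "nat \<Rightarrow> bool" where
  "live t \<longleftrightarrow> (\<forall>s<t. \<forall>v\<in>V. result tap_algorithm (I v) (hist s v) = None)"

lemma hist_live:
  assumes "live t" "s \<le> t" "v \<in> V"
  shows "length (hist s v) = s \<and> (\<forall>s'<s. \<forall>u. {u, v} \<in> E \<longrightarrow> rcv s v s' u = msg s' u)"
  using assms(2,3)
proof (induction s arbitrary: v)
  case (Suc s)
  let ?f = "\<lambda>u. sent tap_algorithm E I (hist s) u v"
  have "hist (Suc s) v = hist s v @ [?f]"
    using assms(1) Suc.prems by (simp add: live_def)
  moreover have "length (hist s v) = s" "\<And>s' u. s' < s \<Longrightarrow> {u, v} \<in> E \<Longrightarrow> rcv s v s' u = msg s' u"
    using Suc by auto
  moreover have "decode (?f u) = msg s u" if u: "{u, v} \<in> E" for u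
  proof -
    have "u \<in> V"
      using u edge_V by blast
    then have "length (hist s u) = s" "result tap_algorithm (I u) (hist s u) = None"
      using Suc assms(1) by (auto simp: live_def)
    then show ?thesis
      using u by (simp add: sent_def tap_algorithm_def decode_encode msg_def)
  qed
  ultimately show ?case
    by (auto simp: received_def nth_append less_Suc_eq)
qed simp

lemma rcv_live:
  "live t \<Longrightarrow> s \<le> t \<Longrightarrow> s' < s \<Longrightarrow> {u, v} \<in> E \<Longrightarrow> rcv s v s' u = msg s' u"
  using hist_live[of t s v] edge_V[of u v] by blast

lemma rcv_parent:
  "live t \<Longrightarrow> s \<le> t \<Longrightarrow> s' < s \<Longrightarrow> v \<in> V \<Longrightarrow> v \<noteq> r \<Longrightarrow> rcv s v s' (pr v) = msg s' (pr v)"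
  using rcv_live pr_edge T_sub_E by blast

lemma rcv_child:
  assumes "live t" "s \<le> t" "s' < s" "c \<in> children v"
  shows "rcv s v s' c = msg s' c"
proof -
  have "{c, v} \<in> E"
    using child_edge[OF assms(4)] T_sub_E by (auto simp: insert_commute)
  then show ?thesis
    by (rule rcv_live[OF assms(1-3)])
qed

lemma msg_simps:
  "m_anc (msg s v) = a_anc (I v) (rcv s v) s"
  "m_done (msg s v) = of_bool (a_done (I v) (rcv s v) s)"
  "m_height (msg s v) = a_height (I v) (rcv s v) s"
  by (simp_all add: msg_def a_message_def Let_def)

section \<open>First phase: ancestor streams and the height\<close>

lemma a_anc_eq:
  assumes "live t" "s \<le> t" "k \<le> s" "v \<in> V"
  shows "a_anc (I v) (rcv s v) k = (if k \<le> depth v then Suc ((pr ^^ k) v) else 0)"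
  using assms(2-4)
proof (induction k arbitrary: s v)
  case (Suc k)
  show ?case
  proof (cases "v = r")
    case False
    then have "a_anc (I v) (rcv s v) (Suc k) = m_anc (msg k (pr v))"
      using Suc.prems rcv_parent[OF assms(1), of s k v] by (simp add: a_anc_def)
    also have "\<dots> = (if k \<le> depth (pr v) then Suc ((pr ^^ k) (pr v)) else 0)"
      unfolding msg_simps using Suc pr_V[OF _ False] by (intro Suc.IH) auto
    finally show ?thesis
      using depth_pr[OF _ False] Suc.prems by (simp add: funpow_swap1)
  qed (simp add: a_anc_def depth_root)
qed (simp add: a_anc_def)

lemma m_anc_eq:
  "live t \<Longrightarrow> s \<le> t \<Longrightarrow> v \<in> V \<Longrightarrow> m_anc (msg s v) = (if s \<le> depth v then Suc ((pr ^^ s) v) else 0)"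
  unfolding msg_simps by (rule a_anc_eq) auto

text \<open>A vertex is done at the height of its subtree. Two bounds suffice:
  \<open>ht - depth v\<close> from above here, and the distance to any descendant from below in
  \<open>done_late\<close>. They meet at the root.\<close>

lemma done_early:
  assumes "live t" "s \<le> t" "k \<le> s" "v \<in> V" "ht \<le> depth v + k"
  shows "a_done (I v) (rcv s v) k"
  using assms(2-5)
proof (induction k arbitrary: s v)
  case 0
  then have "children v = {}"
    using depth_child[of _ v] children_V[of _ v] depth_le_ht by fastforce
  then show ?case
    using 0 by (simp add: a_done_def a_children_I)
next
  case (Suc k)
  have "m_done (rcv s v k c) \<noteq> 0" if c: "c \<in> children v" for c
  proof -
    have "a_done (I c) (rcv k c) k"
      using Suc.prems depth_child[OF c] children_V[OF c] by (intro Suc.IH) auto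
    then show ?thesis
      using rcv_child[OF assms(1) _ _ c, of s k] Suc.prems by (simp add: msg_simps)
  qed
  then show ?case
    using Suc.prems by (simp add: a_done_def a_children_I)
qed

lemma done_late:
  assumes "live t" "s \<le> t" "k \<le> s" "x \<in> V" "i \<le> depth x"
    and "a_done (I ((pr ^^ i) x)) (rcv s ((pr ^^ i) x)) k"
  shows "i \<le> k"
  using assms(2-6)
proof (induction i arbitrary: s k)
  case (Suc i)
  let ?c = "(pr ^^ i) x" and ?v = "(pr ^^ Suc i) x"
  have c: "?c \<in> V" "?c \<noteq> r"
    using iter_pr[of x i] Suc.prems depth_root by auto
  then have child: "?c \<in> children ?v" and v: "?v \<in> V"
    using pr_V by (auto simp: children_def)
  then have "k > 0" "m_done (rcv s ?v (k - 1) ?c) \<noteq> 0"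
    using Suc.prems(5) unfolding a_done_def a_children_I[OF v] by auto
  then have "a_done (I ?c) (rcv (k - 1) ?c) (k - 1)"
    using rcv_child[OF assms(1) _ _ child, of s "k - 1"] Suc.prems by (simp add: msg_simps split: if_splits)
  then have "i \<le> k - 1"
    using Suc.IH[of "k - 1" "k - 1"] Suc.prems by simp
  then show ?case
    using \<open>k > 0\<close> by simp
qed simp

lemma root_done:
  assumes "live t" "s \<le> t" "k \<le> s"
  shows "a_done (I r) (rcv s r) k \<longleftrightarrow> ht \<le> k"
proof
  assume k: "a_done (I r) (rcv s r) k"
  obtain v where v: "v \<in> V" "depth v = ht"
    by (rule ht_attained)
  then have "(pr ^^ ht) v = r"
    using iter_pr[of v ht] depth_eq_0 by auto
  then show "ht \<le> k"
    using done_late[OF assms v(1), of ht] v k by simp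
qed (use done_early[OF assms root_in_V] in simp)

lemma a_height_eq:
  assumes "live t" "s \<le> t" "v \<in> V"
  shows "a_height (I v) (rcv s v) s = (if ht + depth v \<le> s then Suc ht else 0)"
  using assms(2,3)
proof (induction s arbitrary: v)
  case 0
  then show ?case
    using root_done[OF assms(1), of 0 0] ht_pos by (simp add: a_height_def)
next
  case (Suc s)
  show ?case
  proof (cases "v = r")
    case True
    have "(LEAST s'. a_done (I r) (rcv (Suc s) r) s') = ht" if "ht \<le> Suc s"
    proof (rule Least_equality)
      show "a_done (I r) (rcv (Suc s) r) ht"
        using root_done[OF assms(1) Suc.prems(1) that] by simp
      show "ht \<le> k" if "a_done (I r) (rcv (Suc s) r) k" for k
        using root_done[OF assms(1) Suc.prems(1), of k] that \<open>ht \<le> Suc s\<close>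
        by (cases "k \<le> Suc s") auto
    qed
    then show ?thesis
      using root_done[OF assms(1) Suc.prems(1), of "Suc s"] True depth_root
      by (simp add: a_height_def)
  next
    case False
    then show ?thesis
      using Suc pr_V[OF Suc.prems(2) False] depth_pr[OF Suc.prems(2) False]
        rcv_parent[OF assms(1) Suc.prems(1) _ Suc.prems(2) False, of s]
      by (simp add: a_height_def msg_simps)
  qed
qed

abbreviation halt :: nat where
  "halt \<equiv> 5 * ht + 3"

lemma result_eq:
  "result tap_algorithm (I v) (hist t v) = a_result (I v) (rcv t v) (length (hist t v))"
  by (simp add: tap_algorithm_def)

text \<open>Under \<open>live t\<close> the height known in round \<open>t\<close> is correct or
  still absent, so no vertex takes the clock to have reached \<open>5 * ht + 3\<close> too
  early.\<close>

lemma live_halt: "live halt"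
proof -
  have "live t" if "t \<le> halt" for t
    using that
  proof (induction t)
    case (Suc t)
    then have t: "live t" "t < halt"
      by auto
    have "result tap_algorithm (I v) (hist t v) = None" if v: "v \<in> V" for v
      using hist_live[OF t(1) order_refl v] a_height_eq[OF t(1) order_refl v] edge_weights_I[OF v] t
      by (simp add: result_eq a_result_def Let_def)
    then show ?case
      using t by (auto simp: live_def less_Suc_eq)
  qed (simp add: live_def)
  then show ?thesis
    by simp
qed

section \<open>Second phase: prices\<close>

lemma a_depth_eq:
  assumes "ht < s" "s \<le> halt" "v \<in> V"
  shows "a_depth (I v) (rcv s v) = depth v"
proof (cases "v = r")
  case False
  have d: "depth v = Suc (depth (pr v))" "depth v \<le> ht"
    using depth_pr[OF assms(3) False] depth_le_ht[OF assms(3)] by auto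
  have "m_anc (rcv s v k (pr v)) = (if k < depth v then Suc ((pr ^^ k) (pr v)) else 0)" if "k < s" for k
    using rcv_parent[OF live_halt assms(2) that assms(3) False] that assms d
      m_anc_eq[OF live_halt _ pr_V[OF assms(3) False], of k] by auto
  then have "(LEAST k. m_anc (rcv s v k (pr v)) = 0) = depth v"
    using d assms(1) by (intro Least_equality) (auto simp: not_less[symmetric])
  then show ?thesis
    using False by (simp add: a_depth_def)
qed (simp add: a_depth_def depth_root)

text \<open>Read off from the messages instead of being defined recursively;
  \<open>price_rec\<close> then makes the run itself an instance of
  \<open>reduced_weights\<close>.\<close>

definition price :: "nat \<Rightarrow> nat \<Rightarrow> enat" where
  "price v j = decode_enat (m_price (msg (price_time ht (depth v) j) v))"

definition cost :: "nat \<Rightarrow> nat \<Rightarrow> nat \<Rightarrow> enat" where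
  "cost v j u = (if u \<in> children v then price u j - price u (depth v) else enat (w {v, u}))"

lemma a_candidates_eq:
  assumes "ht < s" "s \<le> halt" "v \<in> V" "j < depth v"
  shows "a_candidates ht (I v) (rcv s v) j = reach v j \<union> children v"
proof -
  let ?k = "depth v - Suc j" and ?x = "(pr ^^ (depth v - Suc j)) v"
  have k: "?k \<le> s"
    using depth_le_ht[OF assms(3)] assms(1) by simp
  have anc: "a_anc (I v) (rcv s v) (a_depth (I v) (rcv s v) - Suc j) = Suc ?x"
    unfolding a_depth_eq[OF assms(1-3)] by (subst a_anc_eq[OF live_halt assms(2) k assms(3)]) simp
  have "(\<forall>s'\<le>ht. m_anc (rcv s v s' u) \<noteq> Suc ?x) \<longleftrightarrow> ?x \<notin> ancestors u" if u: "u \<in> links v" for u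
  proof -
    have m: "m_anc (rcv s v s' u) = (if s' \<le> depth u then Suc ((pr ^^ s') u) else 0)" if "s' \<le> ht" for s'
    proof -
      have "rcv s v s' u = msg s' u"
        using u that assms by (intro rcv_live[OF live_halt]) (auto simp: links_def insert_commute)
      then show ?thesis
        using m_anc_eq[OF live_halt, of s' u] that links_V[OF u] by simp
    qed
    have "m_anc (rcv s v s' u) \<noteq> Suc ?x" if "s' \<le> ht" "?x \<notin> ancestors u" for s'
      using m[OF that(1)] that(2) iter_ancestor[of s' u] by auto
    moreover have "\<exists>s'\<le>ht. m_anc (rcv s v s' u) = Suc ?x" if x: "?x \<in> ancestors u"
    proof -
      have du: "depth u \<le> ht"
        using depth_le_ht links_V[OF u] by blast
      obtain i where i: "i \<le> depth u" "?x = (pr ^^ i) u"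
        using x by (auto simp: ancestors_def)
      then show ?thesis
        using m[of i] du by (intro exI[of _ i]) simp
    qed
    ultimately show ?thesis
      by blast
  qed
  then show ?thesis
    unfolding a_candidates_def anc a_children_I[OF assms(3)] a_links_I reach_def by auto
qed

lemma a_cost_eq:
  assumes "ht < s" "s \<le> halt" "price_time ht (depth v) j \<le> s" "v \<in> V" "j < depth v"
    and u: "u \<in> reach v j \<union> children v"
  shows "a_cost ht (I v) (rcv s v) j u = cost v j u"
proof (cases "u \<in> children v")
  case True
  have "a_price ht (I v) (rcv s v) u j' = price u j'" if "j \<le> j'" "j' \<le> depth v" for j'
  proof -
    \<comment> \<open>A child is one level deeper and \<open>j' \<ge> j\<close>, so it sent this
      price in an earlier round than the one in which \<open>v\<close> sends its price for
      \<open>j\<close>.\<close>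
    have "price_time ht (Suc (depth v)) j' < s"
      using that assms(1,3,5) depth_le_ht[of v] assms(4) by (simp add: price_time_def)
    then show ?thesis
      using rcv_child[OF live_halt assms(2) _ True] depth_child[OF True] a_depth_eq[OF assms(1,2,4)]
      by (simp add: a_price_def price_def)
  qed
  then show ?thesis
    using True assms(5) a_depth_eq[OF assms(1,2,4)]
    by (simp add: a_cost_def cost_def a_children_I[OF assms(4)])
next
  case False
  then have "{v, u} \<in> E"
    using u by (auto simp: reach_def links_def)
  then have "the (edge_weights (I v) u) = w {v, u}"
    by (simp add: local_input_def)
  then show ?thesis
    using False by (simp add: a_cost_def cost_def a_children_I[OF assms(4)])
qed

lemma a_min_eq:
  assumes "ht < s" "s \<le> halt" "price_time ht (depth v) j \<le> s" "v \<in> V" "j < depth v"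
  shows "a_min ht (I v) (rcv s v) j = (INF u\<in>reach v j \<union> children v. cost v j u)"
  unfolding a_min_def a_candidates_eq[OF assms(1,2,4,5)]
  using a_cost_eq[OF assms] by (intro INF_cong) auto

lemma m_price_cases:
  assumes "s < halt" "v \<in> V" "m_price (msg s v) \<noteq> 0"
  obtains j where "j < depth v" "s = price_time ht (depth v) j"
proof -
  from assms have "2 * ht + 2 \<le> s" and t: "s + depth v \<le> 4 * ht + 1" "4 * ht + 1 < s + 2 * depth v"
    using a_height_eq[OF live_halt, of s v] a_depth_eq[of s v]
    by (auto simp: msg_def a_message_def Let_def split: if_splits)
  then have "4 * ht + 1 - depth v - s < depth v" "s = price_time ht (depth v) (4 * ht + 1 - depth v - s)"
    by (auto simp: price_time_def)
  then show thesis
    by (rule that)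
qed

lemma m_price_eq:
  assumes "v \<in> V" "j < depth v"
  shows "m_price (msg (price_time ht (depth v) j) v) =
    code_enat (INF u\<in>reach v j \<union> children v. cost v j u)"
proof -
  define s where "s = price_time ht (depth v) j"
  have s: "2 * ht + 2 \<le> s" "s + depth v + j = 4 * ht + 1" "ht + depth v \<le> s" "s \<le> halt"
    using assms depth_le_ht[OF assms(1)] by (auto simp: s_def price_time_def)
  then have j: "4 * ht + 1 - depth v - s = j"
    by simp
  have "a_min ht (I v) (rcv s v) j = (INF u\<in>reach v j \<union> children v. cost v j u)"
    using s assms by (intro a_min_eq) (auto simp: s_def)
  then show ?thesis
    using s assms a_height_eq[OF live_halt, of s v] a_depth_eq[of s v] j
    by (simp add: msg_def a_message_def Let_def flip: s_def)
qed

lemma price_rec: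
  "v \<in> V \<Longrightarrow> j < depth v \<Longrightarrow> price v j = (INF u\<in>reach v j \<union> children v. cost v j u)"
  using m_price_eq[of v j] by (simp add: price_def decode_code_enat)

sublocale reduced_weights V E T r w price
  by unfold_locales (use price_rec in \<open>simp add: cost_def\<close>)

section \<open>Third phase: demands and choices\<close>

definition demand_of :: "nat \<Rightarrow> nat" where
  "demand_of v = a_demand ht (I v) (rcv halt v)"

definition choice_of :: "nat \<Rightarrow> nat" where
  "choice_of v = (SOME u. u \<in> reach v (demand_of v) \<union> children v \<and>
     cost v (demand_of v) u = price v (demand_of v))"

lemma a_demand_eq:
  assumes "4 * ht + 2 + depth v \<le> s" "s \<le> halt" "v \<in> V" "v \<noteq> r"
  shows "a_demand ht (I v) (rcv s v) =
    (let m = msg (4 * ht + 1 + depth v) (pr v)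
     in if m_choice m = Suc v then m_demand m else depth v - 1)"
  using rcv_parent[OF live_halt assms(2) _ assms(3,4), of "4 * ht + 1 + depth v"] assms
    a_depth_eq[OF _ assms(2,3)]
  by (simp add: a_demand_def Let_def)

lemma demand_of_eq:
  assumes "4 * ht + 2 + depth v \<le> s" "s \<le> halt" "v \<in> V" "v \<noteq> r"
  shows "a_demand ht (I v) (rcv s v) = demand_of v"
  using a_demand_eq[OF assms] a_demand_eq[of v halt] assms depth_le_ht[OF assms(3)]
  by (simp add: demand_of_def)

lemma a_choice_eq:
  assumes "4 * ht + 2 + depth v \<le> s" "s \<le> halt" "v \<in> V" "v \<noteq> r" and d: "demand_of v < depth v"
  shows "a_choice ht (I v) (rcv s v) = choice_of v"
proof -
  have s: "ht < s" "price_time ht (depth v) (demand_of v) \<le> s"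
    using assms by (auto simp: price_time_def)
  show ?thesis
    unfolding a_choice_def choice_of_def demand_of_eq[OF assms(1-4)] Let_def
      a_candidates_eq[OF s(1) assms(2,3) d] a_min_eq[OF s(1) assms(2) s(2) assms(3) d]
      price_rec[OF assms(3) d]
    using a_cost_eq[OF s(1) assms(2) s(2) assms(3) d] by (intro arg_cong[of _ _ Eps] ext) auto
qed

text \<open>The choice stays in the form \<open>a_choice\<close> here: identifying it with
  \<open>choice_of\<close> takes \<open>demand_less_depth\<close>, which rests on the second part of
  this lemma.\<close>

lemma choice_msg:
  assumes "s < halt" "v \<in> V"
  shows "m_choice (msg s v) =
      (if v \<noteq> r \<and> s = 4 * ht + 2 + depth v then Suc (a_choice ht (I v) (rcv s v)) else 0)"
    and "m_demand (msg s v) = (if v \<noteq> r \<and> s = 4 * ht + 2 + depth v then demand_of v else 0)"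
proof -
  have d: "depth v \<le> ht"
    using depth_le_ht[OF assms(2)] .
  have ready: "a_height (I v) (rcv s v) s \<noteq> 0 \<and> 2 * (a_height (I v) (rcv s v) s - 1) + 2 \<le> s \<longleftrightarrow>
      2 * ht + 2 \<le> s"
    and h: "2 * ht + 2 \<le> s \<Longrightarrow> a_height (I v) (rcv s v) s = Suc ht"
    using a_height_eq[OF live_halt _ assms(2), of s] assms(1) d by auto
  show "m_choice (msg s v) =
      (if v \<noteq> r \<and> s = 4 * ht + 2 + depth v then Suc (a_choice ht (I v) (rcv s v)) else 0)"
    and "m_demand (msg s v) = (if v \<noteq> r \<and> s = 4 * ht + 2 + depth v then demand_of v else 0)"
  proof (atomize (full), cases "2 * ht + 2 \<le> s")
    case True
    have depth: "a_depth (I v) (rcv s v) = depth v"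
      using True assms by (intro a_depth_eq) auto
    show "m_choice (msg s v) =
        (if v \<noteq> r \<and> s = 4 * ht + 2 + depth v then Suc (a_choice ht (I v) (rcv s v)) else 0) \<and>
      m_demand (msg s v) = (if v \<noteq> r \<and> s = 4 * ht + 2 + depth v then demand_of v else 0)"
      unfolding msg_def a_message_def Let_def ready h[OF True] depth
      using True depth_eq_0[OF assms(2)] demand_of_eq[of v s] assms
      by (cases "v \<noteq> r \<and> s = 4 * ht + 2 + depth v") auto
  next
    case False
    then show "m_choice (msg s v) =
        (if v \<noteq> r \<and> s = 4 * ht + 2 + depth v then Suc (a_choice ht (I v) (rcv s v)) else 0) \<and>
      m_demand (msg s v) = (if v \<noteq> r \<and> s = 4 * ht + 2 + depth v then demand_of v else 0)"
      unfolding msg_def a_message_def Let_def ready by simp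
  qed
qed

lemma demand_less_depth:
  assumes "v \<in> V" "v \<noteq> r"
  shows "demand_of v < depth v"
  using assms
proof (induction "depth v" arbitrary: v rule: less_induct)
  case less
  have d: "depth v = Suc (depth (pr v))" "depth v \<le> ht"
    using depth_pr[OF less.prems] depth_le_ht[OF less.prems(1)] by auto
  let ?m = "msg (4 * ht + 1 + depth v) (pr v)"
  have "demand_of v = (if m_choice ?m = Suc v then m_demand ?m else depth v - 1)"
    using a_demand_eq[OF _ _ less.prems, of halt] d by (simp add: demand_of_def Let_def)
  \<comment> \<open>If the parent is the root or does not announce in this round, the field is 0,
    which is below \<open>depth v\<close> too.\<close>
  moreover have "m_demand ?m < depth v"
    using choice_msg(2)[of "4 * ht + 1 + depth v" "pr v"] pr_V[OF less.prems] d
      less.hyps[of "pr v"] by auto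
  ultimately show ?case
    using d by auto
qed

lemma m_choice_eq:
  assumes "s < halt" "v \<in> V"
  shows "m_choice (msg s v) = (if v \<noteq> r \<and> s = 4 * ht + 2 + depth v then Suc (choice_of v) else 0)"
  using choice_msg(1)[OF assms] a_choice_eq[of v s] demand_less_depth assms by auto

sublocale traceback V E T r w price choice_of demand_of
proof
  fix v assume "v \<in> V - {r}"
  then have v: "v \<in> V" "v \<noteq> r"
    by auto
  have d: "depth v = Suc (depth (pr v))" "depth v \<le> ht"
    using depth_pr[OF v] depth_le_ht[OF v(1)] by auto
  have "demand_of v = (let m = msg (4 * ht + 1 + depth v) (pr v)
      in if m_choice m = Suc v then m_demand m else depth v - 1)"
    using a_demand_eq[OF _ _ v, of halt] d by (simp add: demand_of_def)
  then show "demand_of v =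
      (if pr v \<noteq> r \<and> choice_of (pr v) = v then demand_of (pr v) else depth v - 1)"
    using m_choice_eq[of "4 * ht + 1 + depth v" "pr v"] choice_msg(2)[of "4 * ht + 1 + depth v" "pr v"]
      pr_V[OF v] d by (auto simp: Let_def)
next
  fix v assume "v \<in> V - {r}" and fin: "price v (demand_of v) \<noteq> \<infinity>"
  then have v: "v \<in> V" "v \<noteq> r"
    by auto
  have "\<exists>u. u \<in> reach v (demand_of v) \<union> children v \<and> cost v (demand_of v) u = price v (demand_of v)"
    using fin Inf_enat_attained[of "cost v (demand_of v)"]
    unfolding price_rec[OF v(1) demand_less_depth[OF v]] by blast
  then have "choice_of v \<in> reach v (demand_of v) \<union> children v \<and>
      cost v (demand_of v) (choice_of v) = price v (demand_of v)"
    unfolding choice_of_def by (rule someI_ex)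
  then show "choice_of v \<in> reach v (demand_of v) \<union> children v \<and>
      (if choice_of v \<in> children v
       then price (choice_of v) (demand_of v) - price (choice_of v) (depth v)
       else enat (w {v, choice_of v})) = price v (demand_of v)"
    unfolding cost_def .
qed

lemma result_halt:
  assumes "v \<in> V" "halt \<le> t"
  shows "result tap_algorithm (I v) (hist t v) = Some {u. {v, u} \<in> selected}"
proof (rule run_halted[OF _ assms(2)])
  have d: "depth v \<le> ht"
    using depth_le_ht[OF assms(1)] .
  have own: "v \<noteq> r \<Longrightarrow> a_choice ht (I v) (rcv halt v) = choice_of v"
    using a_choice_eq[of v halt] demand_less_depth assms(1) d by auto
  have nbr: "(\<exists>s\<le>5 * ht + 2. m_choice (rcv halt v s u) = Suc v) \<longleftrightarrow> u \<noteq> r \<and> choice_of u = v"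
    if u: "u \<in> links v" for u
  proof -
    have m: "m_choice (rcv halt v s u) =
        (if u \<noteq> r \<and> s = 4 * ht + 2 + depth u then Suc (choice_of u) else 0)" if "s \<le> 5 * ht + 2" for s
    proof -
      have "rcv halt v s u = msg s u"
        using u that by (intro rcv_live[OF live_halt]) (auto simp: links_def insert_commute)
      then show ?thesis
        using m_choice_eq[of s u] that links_V[OF u] by simp
    qed
    have "4 * ht + 2 + depth u \<le> 5 * ht + 2"
      using depth_le_ht links_V[OF u] by simp
    then show ?thesis
      using m m[of "4 * ht + 2 + depth u"] by (metis nat.inject nat.distinct(1))
  qed
  have "result tap_algorithm (I v) (hist halt v) =
      Some {u \<in> links v. v \<noteq> r \<and> choice_of v = u \<or> u \<noteq> r \<and> choice_of u = v}"
    using hist_live[OF live_halt order_refl assms(1)] a_height_eq[OF live_halt order_refl assms(1)]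
      edge_weights_I[OF assms(1)] d own nbr
    by (auto simp: result_eq a_result_def Let_def a_links_I)
  then show "result tap_algorithm (I v) (hist halt v) = Some {u. {v, u} \<in> selected}"
    unfolding selected_nbrs[OF assms(1)] .
qed

section \<open>Message length\<close>

lemma msg_bounded:
  assumes data: "log_bit_data k V E w" and "s < halt" "v \<in> V"
    and x: "x \<in> {m_anc (msg s v), m_done (msg s v), m_height (msg s v),
      m_price (msg s v), m_choice (msg s v), m_demand (msg s v)}"
  shows "x \<le> card V ^ Suc k"
proof -
  let ?n = "card V"
  have ids: "u < ?n ^ k" if "u \<in> V" for u
    using data that by (simp add: log_bit_data_def)
  have weights: "w e < ?n ^ k" if "e \<in> E" for e
    using data that by (simp add: log_bit_data_def)
  have n: "?n > 0"
    using finite_V root_in_V card_gt_0_iff by blast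
  \<comment> \<open>Identifiers and weights are strictly below \<open>?n ^ k\<close>, which absorbs
    the shift by one; heights and depths are bounded by \<open>?n\<close>. The exponent
    \<open>Suc k\<close> covers both.\<close>
  have pow: "?n ^ k \<le> ?n ^ Suc k" "?n \<le> ?n ^ Suc k"
    using n power_increasing[of k "Suc k" ?n] power_increasing[of 1 "Suc k" ?n] by auto
  have ht: "Suc ht \<le> ?n"
    using ht_attained depth_less_card by (metis Suc_leI)
  have "m_anc (msg s v) \<le> ?n ^ k"
    using m_anc_eq[OF live_halt _ assms(3), of s] assms(2) ids iter_pr[OF assms(3), of s]
    by (auto simp: Suc_le_eq)
  moreover have "m_done (msg s v) \<le> ?n"
    using n by (simp add: msg_simps)
  moreover have "m_height (msg s v) \<le> ?n"
    using a_height_eq[OF live_halt _ assms(3), of s] assms(2) ht by (simp add: msg_simps)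
  moreover have "m_price (msg s v) \<le> ?n ^ k"
  proof (cases "m_price (msg s v) = 0")
    case False
    then obtain j where j: "j < depth v" "s = price_time ht (depth v) j"
      using m_price_cases assms by blast
    then have eq: "m_price (msg s v) = code_enat (price v j)"
      using m_price_eq[OF assms(3) j(1)] price_rec[OF assms(3) j(1)] by simp
    then obtain p where p: "price v j = enat p"
      using False by (auto simp: code_enat_def split: enat.splits)
    then obtain e where e: "e \<in> E" "price v j \<le> w e"
      using g_bounded[OF assms(3) j(1)] by auto
    then have "m_price (msg s v) \<le> Suc (w e)"
      using eq p by (simp add: code_enat_def)
    then show ?thesis
      using weights[OF e(1)] by simp
  qed simp
  moreover have "m_choice (msg s v) \<le> ?n ^ k"
    using m_choice_eq[OF assms(2,3)] ids choice_V[of v] assms(3) by (simp add: Suc_le_eq)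
  moreover have "m_demand (msg s v) \<le> ?n"
    using choice_msg(2)[OF assms(2,3)] demand_less_depth[OF assms(3)] depth_less_card[OF assms(3)]
    by (auto simp: less_imp_le)
  ultimately show ?thesis
    using x pow by (auto intro: order_trans)
qed

lemma bandwidth:
  assumes data: "log_bit_data k V E w"
  shows "bandwidth_at_most (real (12 * k + 30) * log 2 (real (card V))) tap_algorithm E I"
  unfolding bandwidth_at_most_def
proof (intro allI)
  fix t u v :: nat
  let ?n = "card V"
  have "?n \<ge> 2"
  proof -
    obtain x where x: "{r, x} \<in> E"
      using ex_neighbour[OF root_in_V] by auto
    then have "{r, x} \<subseteq> V" "card {r, x} = 2"
      using edge_V edge_neq by auto
    then show ?thesis
      using card_mono[OF finite_V] by metis
  qed
  then have log: "log 2 (real ?n) \<ge> 1"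
    by (subst le_log_iff) auto
  show "real (length (sent tap_algorithm E I (hist t) u v)) \<le> real (12 * k + 30) * log 2 (real (card V))"
  proof (cases "{u, v} \<in> E \<and> t < halt")
    case True
    then have u: "u \<in> V"
      using edge_V by blast
    have t: "live t"
      using live_halt True by (auto simp: live_def)
    \<comment> \<open>With \<open>L = log 2 (real ?n) \<ge> 1\<close>, a nonzero field takes at most
      \<open>3 + 2 * (k + 1) * L \<le> (2 * k + 5) * L\<close> bits; six fields give the factor
      \<open>12 * k + 30\<close>.\<close>
    have len: "real (length (encode_nat x)) \<le> real (2 * k + 5) * log 2 (real ?n)"
      if "x \<in> {m_anc (msg t u), m_done (msg t u), m_height (msg t u),
        m_price (msg t u), m_choice (msg t u), m_demand (msg t u)}" for x
    proof (cases "x = 0")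
      case True
      then have "real (length (encode_nat x)) \<le> 1 * 1"
        by (simp add: encode_nat.simps)
      also have "\<dots> \<le> real (2 * k + 5) * log 2 (real ?n)"
        using log by (intro mult_mono) auto
      finally show ?thesis .
    next
      case False
      have "x \<le> ?n ^ Suc k"
        using msg_bounded[OF data _ u that] \<open>{u, v} \<in> E \<and> t < halt\<close> by blast
      then have "real x \<le> real ?n ^ Suc k"
        by (metis of_nat_le_iff of_nat_power)
      then have "log 2 (real x) \<le> log 2 (real ?n ^ Suc k)"
        using False \<open>?n \<ge> 2\<close> by (subst log_le_cancel_iff) auto
      also have "\<dots> = real (Suc k) * log 2 (real ?n)"
        using \<open>?n \<ge> 2\<close> by (subst log_nat_power) auto
      finally have "real (length (encode_nat x)) \<le> 3 + 2 * (real (Suc k) * log 2 (real ?n))"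
        using length_encode_nat[of x] False by simp
      then show ?thesis
        using log by (simp add: algebra_simps)
    qed
    have "result tap_algorithm (I u) (hist t u) = None" "length (hist t u) = t"
      using live_halt True u hist_live[OF t order_refl u] by (auto simp: live_def)
    then have "sent tap_algorithm E I (hist t) u v = encode (msg t u)"
      using True by (simp add: sent_def tap_algorithm_def msg_def)
    then have "real (length (sent tap_algorithm E I (hist t) u v)) \<le> 6 * (real (2 * k + 5) * log 2 (real ?n))"
      using len[of "m_anc (msg t u)"] len[of "m_done (msg t u)"] len[of "m_height (msg t u)"]
        len[of "m_price (msg t u)"] len[of "m_choice (msg t u)"] len[of "m_demand (msg t u)"]
      by (simp add: encode_def)
    then show ?thesis
      by (simp add: algebra_simps)
  next
    case False
    have "sent tap_algorithm E I (hist t) u v = []"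
      using False result_halt[of u t] edge_V[of u v] by (auto simp: sent_def)
    then show ?thesis
      using log by simp
  qed
qed

end

section \<open>Correctness and round complexity\<close>

lemma tap_algorithm_correct:
  assumes inst: "tap_instance V E T r" and data: "log_bit_data k V E w"
  shows "bandwidth_at_most (real (12 * k + 30) * log 2 (real (card V))) tap_algorithm E (local_input E T r w) \<and>
    (\<exists>Aug. computes_within (8 * height V T r) tap_algorithm V E (local_input E T r w)
        (\<lambda>v. {u. {v, u} \<in> Aug}) \<and>
      augmentation V E T Aug \<and>
      (\<forall>OPT. optimal_augmentation V E T w OPT \<longrightarrow> sum w Aug \<le> 2 * sum w OPT))"
proof (cases "E = {}")
  \<comment> \<open>By connectivity there is a single vertex, so neither rounds nor bits are
    available, and the empty augmentation is output at once.\<close>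
  case True
  have empty: "edge_weights (local_input E T r w v) = Map.empty" for v
    by (simp add: local_input_def True)
  have "T = {}"
    using inst True by (auto simp: tap_instance_def spanning_tree_def)
  then have "augmentation V E T {}"
    using inst True by (simp add: augmentation_def tap_instance_def)
  moreover have "computes_within t tap_algorithm V E (local_input E T r w) (\<lambda>v. {u. {v, u} \<in> {}})" for t
    by (simp add: computes_within_def tap_algorithm_def a_result_def empty)
  moreover have "card V > 0"
    using inst card_gt_0_iff by (auto simp: tap_instance_def simple_graph_def)
  then have "bandwidth_at_most (real (12 * k + 30) * log 2 (real (card V))) tap_algorithm E (local_input E T r w)"
    by (simp add: bandwidth_at_most_def sent_def True)
  ultimately show ?thesis
    by (intro conjI exI[of _ "{}"]) auto
next
  case False
  then interpret tap_network V E T r w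
    using inst by unfold_locales
  \<comment> \<open>Since \<open>ht \<ge> 1\<close>, the additive 3 in \<open>halt\<close> is at
    most \<open>3 * ht\<close>.\<close>
  have "halt \<le> 8 * ht"
    using ht_pos by simp
  then have "computes_within (8 * ht) tap_algorithm V E I (\<lambda>v. {u. {v, u} \<in> selected})"
    using result_halt by (simp add: computes_within_def)
  moreover have "sum w selected \<le> 2 * sum w OPT" if "optimal_augmentation V E T w OPT" for OPT
    using that selected_2_approx by (simp add: optimal_augmentation_def)
  ultimately show ?thesis
    using bandwidth[OF data] selected_augmentation by (intro conjI exI[of _ selected]) auto
qed

theorem theorem1:
  shows "\<exists>(A :: (tap_input, nat set) congest_algorithm) (C :: nat). \<forall>k :: nat. \<exists>c :: real.
    \<forall>(V :: nat set) (E :: nat set set) (T :: nat set set) (r :: nat) (w :: nat set \<Rightarrow> nat).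
      tap_instance V E T r \<and> log_bit_data k V E w \<longrightarrow>
        bandwidth_at_most (c * log 2 (real (card V))) A E (local_input E T r w) \<and>
        (\<exists>Aug. computes_within (C * height V T r) A V E (local_input E T r w)
                  (\<lambda>v. {u. {v, u} \<in> Aug}) \<and>
               augmentation V E T Aug \<and>
               (\<forall>OPT. optimal_augmentation V E T w OPT \<longrightarrow> sum w Aug \<le> 2 * sum w OPT))"
  by (rule exI[of _ tap_algorithm], rule exI[of _ 8], rule allI,
      rule exI[of _ "real (12 * k + 30)" for k], intro allI impI, elim conjE, rule tap_algorithm_correct)

end
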